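(* Let $G=\mathrm{USp}(4)$ and let $H=\mathrm{SU}(2)\times\mathrm{SU}(2)$, embedded block-diagonally in $G$. For $g\in G$ with eigenvalues $e^{\pm i\theta_1},e^{\pm i\theta_2}$, let $s_1(g)=\mathrm{tr}(g)=2\cos\theta_1+2\cos\theta_2\in[-4,4]$, and set $\varepsilon=s_1+4\in[0,8]$. Let $\mu_G(\varepsilon)$ and $\mu_H(\varepsilon)$ denote the push-forwards of the normalized Haar measures on $G$ and $H$ under $\varepsilon=s_1+4$. Then, as $\varepsilon\to 0^+$, $$\mu_G(\varepsilon)=\left(\frac{\varepsilon^4(8-\varepsilon)}{512\pi}+O(\varepsilon^6)\right)d\varepsilon=\left(\frac{\varepsilon^4}{64\pi}-\frac{\varepsilon^5}{512\pi}+O(\varepsilon^6)\right)d\varepsilon,$$ and $$\mu_H(\varepsilon)=\left(\frac{\varepsilon^2(8-\varepsilon)}{64\pi}+O(\varepsilon^4)\right)d\varepsilon=\left(\frac{\varepsilon^2}{8\pi}-\frac{\varepsilon^3}{64\pi}+O(\varepsilon^4)\right)d\varepsilon.$$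
   Context: $\mathrm{USp}(4)$ is the compact unitary symplectic group of $4\times 4$ matrices; every element has eigenvalues of the form $e^{\pm i\theta_1}, e^{\pm i\theta_2}$ with $\theta_j\in[0,\pi]$. $\mathrm{SU}(2)=\mathrm{USp}(2)$, and $H$ acts block-diagonally, so the trace of $(g_1,g_2)\in H$ is $\mathrm{tr}(g_1)+\mathrm{tr}(g_2)$. Haar measures are normalized to total mass $1$. *)

theory Defs
  imports "HOL-Probability.Probability" "HOL-Library.Landau_Symbols"
begin

definition cadj :: "complex^'n^'n \<Rightarrow> complex^'n^'n" where
  "cadj A = (\<chi> i j. cnj (A $ j $ i))"

definition unitary_mats :: "(complex^'n^'n) set" where
  "unitary_mats = {U. U ** cadj U = mat 1}"

definition SU2 :: "(complex^2^2) set" where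
  "SU2 = {U. U \<in> unitary_mats \<and> det U = 1}"

text \<open>Symplectic form J = omega (+) omega on C^4, omega = [[0,1],[-1,0]];
  with this J the block-diagonal SU(2) x SU(2) lies in USp(4).\<close>
definition J4 :: "complex^4^4" where
  "J4 = (\<chi> i j. if (i = 0 \<and> j = 1) \<or> (i = 2 \<and> j = 3) then 1
               else if (i = 1 \<and> j = 0) \<or> (i = 3 \<and> j = 2) then -1 else 0)"

definition USp4 :: "(complex^4^4) set" where
  "USp4 = {U. U \<in> unitary_mats \<and> transpose U ** J4 ** U = J4}"

definition blk1 :: "4 \<Rightarrow> bool" where "blk1 i = (i = 0 \<or> i = 1)"
definition idx2 :: "4 \<Rightarrow> 2" where "idx2 i = (if i = 0 \<or> i = 2 then 0 else 1)"

definition blockdiag :: "complex^2^2 \<Rightarrow> complex^2^2 \<Rightarrow> complex^4^4" where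
  "blockdiag A B = (\<chi> i j. if blk1 i \<and> blk1 j then A $ idx2 i $ idx2 j
                          else if \<not> blk1 i \<and> \<not> blk1 j then B $ idx2 i $ idx2 j else 0)"

definition H4 :: "(complex^4^4) set" where
  "H4 = {blockdiag A B | A B. A \<in> SU2 \<and> B \<in> SU2}"

definition is_haar :: "(complex^'n^'n) set \<Rightarrow> (complex^'n^'n) measure \<Rightarrow> bool" where
  "is_haar G M \<longleftrightarrow> sets M = sets borel \<and> prob_space M \<and> emeasure M G = 1 \<and>
     (\<forall>g\<in>G. distr M borel (\<lambda>x. g ** x) = M)"

definition haar :: "(complex^'n^'n) set \<Rightarrow> (complex^'n^'n) measure" where
  "haar G = (THE M. is_haar G M)"

text \<open>Push-forward of Haar measure under epsilon = tr + 4 (trace is real here).\<close>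
definition mu_eps :: "(complex^'n^'n) set \<Rightarrow> real measure" where
  "mu_eps G = distr (haar G) lborel (\<lambda>U. Re (trace U) + 4)"

end

theory Submission
  imports Defs
begin

text \<open>
  A quaternionic unitary matrix is given by its first column \<open>x = (a, c)\<close>, uniform on the sphere \<open>S\<^sup>7\<close>, and a unit
  quaternion \<open>p\<close>, uniform on \<open>S\<^sup>3\<close>, which moves a fixed unit vector orthogonal to \<open>x\<close> to the second column.
  That vector can be chosen such that the lower diagonal entry is \<open>norm a\<close> times a unit quaternion which is
  again uniform and independent of \<open>a\<close>. Hence the trace on \<open>USp4\<close> is distributed as \<open>t\<close> times the trace on
  \<open>SU(2) \<times> SU(2)\<close>, where the independent factor \<open>t = norm a\<close> has density \<open>12 t\<^sup>3 (1 - t\<^sup>2)\<close> on the unit interval. The trace on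
  \<open>SU(2) \<times> SU(2)\<close> is a sum of two independent semicircular variables, so its density is a convolution, and
  near the edge both densities are estimated by elementary integrals.
\<close>

subsection \<open>Uniform measure on the unit sphere\<close>

text \<open>\<open>haar\<close> is a definite description, so an explicit candidate is of use only
  together with a uniqueness proof. Given that, both Haar measures are images of products of
  spheres, and no integration formula over a maximal torus is needed. The map from USp(4) to S^7
  taking the first column has fibre SU(2). \<open>frame4\<close> is a measurable section of it; its
  failure to be equivariant is a right factor in the fibre, which integration over S^3 absorbs. Many
  sections would do for this; the one used is chosen so that the trace factors. The constant 12
  arises because \<open>t\<^sup>2\<close> has the Beta(2,2) law. The exponents at the edge have a
  simple origin. Two square-root edges convolve to the area of a half disc, of order
  \<open>e\<^sup>2\<close>. On USp(4) only \<open>t > 1 - e / 4\<close> contributes, an interval of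
  length \<open>e / 4\<close> on which \<open>1 - t\<^sup>2\<close> is at most \<open>e / 2\<close>.
  These two factors raise the order of the density from 2 to 4 and the order of the error from 4 to
  6.\<close>

lemmas [measurable] = borel_open[OF open_ball]

text \<open>
  A translation-invariant measure \<open>\<nu>\<close> satisfies \<open>\<nu> A * lborel B = lborel A * \<nu> (- B)\<close> by Fubini;
  taking for \<open>B\<close> the unit ball shows that the image of Lebesgue measure is Lebesgue measure.
\<close>
lemma distr_lborel_linear_isometry:
  fixes f :: "'a::euclidean_space \<Rightarrow> 'b::euclidean_space"
  assumes lin: "linear f" and nrm: "\<And>x. norm (f x) = norm x" and surj: "surj f"
  shows "distr lborel borel f = lborel"
proof -
  have inj: "inj f"
    using lin nrm by (metis linear_injective_0 norm_eq_zero)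
  have dim: "DIM('a) = DIM('b)"
    using dim_image_eq[OF lin, of UNIV] inj surj
    by (simp add: span_UNIV)
  have [measurable]: "f \<in> borel_measurable borel"
    using lin linear_continuous_on linear_conv_bounded_linear borel_measurable_continuous_onI by blast
  define \<nu> where "\<nu> = distr lborel borel f"
  have sets_\<nu>[measurable_cong, simp]: "sets \<nu> = sets borel" and space_\<nu>[simp]: "space \<nu> = UNIV"
    by (simp_all add: \<nu>_def)
  \<comment> \<open>Balls are the only sets whose \<open>\<nu>\<close>-measure is computed directly:
    they make \<open>\<nu>\<close> sigma-finite, as Fubini requires, and fix the proportionality
    constant at 1.\<close>
  have ball_\<nu>: "emeasure \<nu> (ball 0 r) = emeasure lborel (ball (0::'b) r)" if "0 \<le> r" for r
  proof -
    have "f -` ball 0 r = ball 0 r" by (auto simp: nrm)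
    then show ?thesis using that
      by (simp add: \<nu>_def emeasure_distr emeasure_ball dim)
  qed
  have "sigma_finite_measure \<nu>"
  proof
    show "\<exists>A. countable A \<and> A \<subseteq> sets \<nu> \<and> \<Union> A = space \<nu> \<and> (\<forall>a\<in>A. emeasure \<nu> a \<noteq> \<infinity>)"
    proof (intro exI[of _ "range (\<lambda>n::nat. ball (0::'b) (real n))"] conjI ballI)
      show "\<Union> (range (\<lambda>n. ball (0::'b) (real n))) = space \<nu>"
        using reals_Archimedean2 by auto
      show "emeasure \<nu> a \<noteq> \<infinity>" if "a \<in> range (\<lambda>n::nat. ball (0::'b) (real n))" for a
        using that emeasure_lborel_ball_finite[of "0::'b"] by (auto simp: ball_\<nu> less_top)
    qed auto
  qed
  then interpret \<nu>: sigma_finite_measure \<nu> .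
  interpret P: pair_sigma_finite \<nu> "lborel :: 'b measure" ..
  have transl: "(\<integral>\<^sup>+x. h (x + y) \<partial>\<nu>) = (\<integral>\<^sup>+x. h x \<partial>\<nu>)"
    if [measurable]: "h \<in> borel_measurable borel" for h y
  proof -
    obtain y' where y: "y = f y'" using surj by auto
    have "(\<integral>\<^sup>+x. h (x + y) \<partial>\<nu>) = (\<integral>\<^sup>+x. h (f (y' + x)) \<partial>lborel)"
      by (simp add: \<nu>_def nn_integral_distr y linear_add[OF lin] add.commute)
    also have "\<dots> = (\<integral>\<^sup>+x. h (f x) \<partial>distr lborel borel ((+) y'))"
      by (simp add: nn_integral_distr)
    finally show ?thesis
      by (simp add: \<nu>_def nn_integral_distr lborel_distr_plus)
  qed
  let ?B = "ball (0::'b) 1"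
  have "emeasure \<nu> A = emeasure lborel A" if A: "A \<in> sets borel" for A :: "'b set"
  proof -
    have [measurable]: "A \<in> sets borel" by fact
    have "emeasure \<nu> A * emeasure lborel ?B = (\<integral>\<^sup>+x. indicator A x * emeasure lborel ?B \<partial>\<nu>)"
      by (simp add: nn_integral_multc)
    also have "\<dots> = (\<integral>\<^sup>+x. \<integral>\<^sup>+y. indicator A x * indicator ?B y \<partial>lborel \<partial>\<nu>)"
      by (simp add: nn_integral_cmult_indicator)
    also have "\<dots> = (\<integral>\<^sup>+x. \<integral>\<^sup>+y. indicator A x * indicator ?B (y - x) \<partial>lborel \<partial>\<nu>)"
    proof (rule nn_integral_cong)
      fix x
      have "(\<integral>\<^sup>+y. indicator A x * indicator ?B y \<partial>lborel) =
            (\<integral>\<^sup>+y. indicator A x * indicator ?B y \<partial>distr lborel borel ((+) (- x)))"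
        by (simp add: lborel_distr_plus)
      also have "\<dots> = (\<integral>\<^sup>+y. indicator A x * indicator ?B (y - x) \<partial>lborel)"
        by (simp add: nn_integral_distr)
      finally show "(\<integral>\<^sup>+y. indicator A x * indicator ?B y \<partial>lborel) =
          (\<integral>\<^sup>+y. indicator A x * indicator ?B (y - x) \<partial>lborel)" .
    qed
    also have "\<dots> = (\<integral>\<^sup>+y. \<integral>\<^sup>+x. indicator A x * indicator ?B (y - x) \<partial>\<nu> \<partial>lborel)"
      by (rule P.Fubini'[symmetric]) measurable
    also have "\<dots> = (\<integral>\<^sup>+y. \<integral>\<^sup>+x. indicator A (x + y) * indicator ?B x \<partial>\<nu> \<partial>lborel)"
    proof (rule nn_integral_cong)
      fix y
      have "indicator ?B (y - (x + y)) = (indicator ?B x :: ennreal)" for x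
        by (simp split: split_indicator)
      with transl[of "\<lambda>x. indicator A x * indicator ?B (y - x)" y]
      show "(\<integral>\<^sup>+x. indicator A x * indicator ?B (y - x) \<partial>\<nu>) = (\<integral>\<^sup>+x. indicator A (x + y) * indicator ?B x \<partial>\<nu>)"
        by simp
    qed
    also have "\<dots> = (\<integral>\<^sup>+x. \<integral>\<^sup>+y. indicator A (x + y) * indicator ?B x \<partial>lborel \<partial>\<nu>)"
      by (rule P.Fubini') measurable
    also have "\<dots> = (\<integral>\<^sup>+x. emeasure lborel A * indicator ?B x \<partial>\<nu>)"
    proof (rule nn_integral_cong)
      fix x
      have "(\<integral>\<^sup>+y. indicator A (x + y) * indicator ?B x \<partial>lborel) =
            (\<integral>\<^sup>+y. indicator A y * indicator ?B x \<partial>distr lborel borel ((+) x))"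
        by (simp add: nn_integral_distr)
      also have "\<dots> = emeasure lborel A * indicator ?B x"
        by (simp add: lborel_distr_plus nn_integral_multc)
      finally show "(\<integral>\<^sup>+y. indicator A (x + y) * indicator ?B x \<partial>lborel) = emeasure lborel A * indicator ?B x" .
    qed
    also have "\<dots> = emeasure lborel A * emeasure lborel ?B"
      by (simp add: nn_integral_cmult ball_\<nu>)
    finally have *: "emeasure \<nu> A * emeasure lborel ?B = emeasure lborel A * emeasure lborel ?B" .
    have "emeasure lborel ?B \<noteq> 0" "emeasure lborel ?B \<noteq> \<infinity>"
      by (simp_all add: emeasure_ball ennreal_eq_0_iff unit_ball_vol_pos not_le)
    with * show ?thesis
      by (metis ennreal_mult_cancel_left infinity_ennreal_def mult.commute top.not_eq_extremum)
  qed
  then show ?thesis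
    unfolding \<nu>_def[symmetric] by (intro measure_eqI) auto
qed

text \<open>Surface measure normalised to mass 1, obtained by pushing the uniform law on the ball
  outwards. Since \<open>sgn 0 = 0\<close>, the centre is sent off the sphere, so facts about unit
  vectors hold only almost everywhere.\<close>

definition sphere_measure :: "'a::euclidean_space measure" where
  "sphere_measure = distr (uniform_measure lborel (ball 0 1)) borel sgn"

lemma sets_sphere_measure [simp, measurable_cong]: "sets sphere_measure = sets borel"
  and space_sphere_measure [simp]: "space sphere_measure = UNIV"
  by (simp_all add: sphere_measure_def)

lemma emeasure_unit_ball_nontriv:
  "emeasure lborel (ball (0::'a::euclidean_space) 1) \<noteq> 0"
  "emeasure lborel (ball (0::'a::euclidean_space) 1) \<noteq> \<infinity>"
  by (simp_all add: emeasure_ball ennreal_eq_0_iff unit_ball_vol_pos not_le)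

interpretation sphere: prob_space "sphere_measure :: 'a::euclidean_space measure"
proof -
  have "prob_space (uniform_measure lborel (ball 0 1) :: 'a measure)"
    using emeasure_unit_ball_nontriv by (intro prob_space_uniform_measure)
  then show "prob_space (sphere_measure :: 'a measure)"
    unfolding sphere_measure_def by (rule prob_space.prob_space_distr) simp
qed

lemma nn_integral_sphere_measure:
  fixes h :: "'a::euclidean_space \<Rightarrow> ennreal"
  assumes [measurable]: "h \<in> borel_measurable borel"
  shows "(\<integral>\<^sup>+x. h x \<partial>sphere_measure) =
    (\<integral>\<^sup>+x. h (sgn x) * indicator (ball 0 1) x \<partial>lborel) / emeasure lborel (ball (0::'a) 1)"
  unfolding sphere_measure_def
  by (simp add: nn_integral_distr nn_integral_uniform_measure)

lemma AE_norm_sphere_measure: "AE x in sphere_measure. norm (x::'a::euclidean_space) = 1"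
proof -
  have "AE x in uniform_measure lborel (ball 0 1). norm (sgn (x::'a)) = 1"
    using AE_lborel_singleton[of "0::'a"] emeasure_unit_ball_nontriv
    by (intro AE_uniform_measureI) (auto simp: norm_sgn)
  then show ?thesis
    unfolding sphere_measure_def by (subst AE_distr_iff) auto
qed

text \<open>A norm-preserving linear map commutes with \<open>sgn\<close> and maps ball to ball, so
  the invariance of Lebesgue measure passes to the sphere. Allowing two different types lets the
  same fact serve as a change of coordinates besides rotation invariance.\<close>

lemma distr_sphere_measure_isometry:
  fixes f :: "'a::euclidean_space \<Rightarrow> 'b::euclidean_space"
  assumes lin: "linear f" and nrm: "\<And>x. norm (f x) = norm x" and surj: "surj f"
  shows "distr sphere_measure borel f = sphere_measure"
proof (rule measure_eqI)
  fix A assume A: "A \<in> sets (distr sphere_measure borel f)"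
  have [measurable]: "f \<in> borel_measurable borel"
    using lin linear_continuous_on linear_conv_bounded_linear borel_measurable_continuous_onI by blast
  have [measurable]: "A \<in> sets borel" using A by simp
  note iso = distr_lborel_linear_isometry[OF assms]
  have sgn: "f (sgn x) = sgn (f x)" for x
    by (simp add: sgn_div_norm linear_scale[OF lin] nrm)
  have ball: "indicator (ball 0 1) (f x) = (indicator (ball 0 1) x :: ennreal)" for x
    by (simp add: nrm split: split_indicator)
  have eq: "(\<integral>\<^sup>+x. h (f x) \<partial>lborel) = (\<integral>\<^sup>+x. h x \<partial>lborel)" if "h \<in> borel_measurable borel" for h
    by (subst iso[symmetric]) (use that in \<open>simp add: nn_integral_distr\<close>)
  have vol: "emeasure lborel (ball (0::'a) 1) = emeasure lborel (ball (0::'b) 1)"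
    using eq[of "indicator (ball 0 1)"] unfolding ball by (simp add: borel_measurable_indicator)
  have "emeasure (distr sphere_measure borel f) A = (\<integral>\<^sup>+x. indicator A x \<partial>distr sphere_measure borel f)"
    by simp
  also have "\<dots> = (\<integral>\<^sup>+x. indicator A (f x) \<partial>sphere_measure)"
    by (rule nn_integral_distr) auto
  also have "\<dots> = (\<integral>\<^sup>+x. indicator A x \<partial>sphere_measure)"
    using eq[of "\<lambda>x. indicator A (sgn x) * indicator (ball 0 1) x"]
    by (simp add: nn_integral_sphere_measure ball vol sgn del: nn_integral_indicator)
  also have "\<dots> = emeasure sphere_measure A" by simp
  finally show "emeasure (distr sphere_measure borel f) A = emeasure sphere_measure A" .
qed simp

lemma nn_integral_sphere_measure_isometry:
  fixes f :: "'a::euclidean_space \<Rightarrow> 'b::euclidean_space"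
  assumes lin: "linear f" and "\<And>x. norm (f x) = norm x" "surj f" and [measurable]: "h \<in> borel_measurable borel"
  shows "(\<integral>\<^sup>+x. h (f x) \<partial>sphere_measure) = (\<integral>\<^sup>+x. h x \<partial>sphere_measure)"
proof -
  have [measurable]: "f \<in> borel_measurable borel"
    using lin linear_continuous_on linear_conv_bounded_linear borel_measurable_continuous_onI by blast
  show ?thesis
    by (subst distr_sphere_measure_isometry[OF assms(1-3), symmetric]) (simp add: nn_integral_distr)
qed

section \<open>Polar coordinates for Lebesgue measure\<close>

definition radial_measure :: "nat \<Rightarrow> real measure" where
  "radial_measure n = density lborel (\<lambda>r. ennreal (real n * unit_ball_vol n * r ^ (n - 1)) * indicator {0..} r)"

lemma sets_radial_measure [simp, measurable_cong]: "sets (radial_measure n) = sets borel"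
  and space_radial_measure [simp]: "space (radial_measure n) = UNIV"
  by (simp_all add: radial_measure_def)

lemma emeasure_radial_measure_lessThan:
  assumes "n > 0"
  shows "emeasure (radial_measure n) {..<r} = (if 0 < r then ennreal (unit_ball_vol n * r ^ n) else 0)"
proof (cases "0 < r")
  case True
  have "emeasure (radial_measure n) {..<r} =
     (\<integral>\<^sup>+s. ennreal (real n * unit_ball_vol n * s ^ (n - 1)) * indicator {0..} s * indicator {..<r} s \<partial>lborel)"
    by (simp add: radial_measure_def emeasure_density)
  also have "\<dots> = (\<integral>\<^sup>+s. ennreal (real n * unit_ball_vol n * s ^ (n - 1)) * indicator {0..r} s \<partial>lborel)"
    using AE_lborel_singleton[of r] by (intro nn_integral_cong_AE) (auto split: split_indicator)
  also have "\<dots> = ennreal (unit_ball_vol n * r ^ n - unit_ball_vol n * 0 ^ n)"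
    using True assms by (intro nn_integral_FTC_Icc) (auto intro!: derivative_eq_intros)
  finally show ?thesis using True assms by simp
next
  case False
  have "emeasure (radial_measure n) {..<r} =
     (\<integral>\<^sup>+s. ennreal (real n * unit_ball_vol n * s ^ (n - 1)) * indicator {0..} s * indicator {..<r} s \<partial>lborel)"
    by (simp add: radial_measure_def emeasure_density)
  also have "\<dots> = (\<integral>\<^sup>+s. 0 \<partial>(lborel :: real measure))"
    using False by (intro nn_integral_cong) (auto split: split_indicator)
  finally show ?thesis using False by simp
qed

lemma sigma_finite_radial_measure:
  assumes "n > 0"
  shows "sigma_finite_measure (radial_measure n)"
proof
  show "\<exists>A. countable A \<and> A \<subseteq> sets (radial_measure n) \<and> \<Union> A = space (radial_measure n) \<and>
     (\<forall>a\<in>A. emeasure (radial_measure n) a \<noteq> \<infinity>)"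
    by (intro exI[of _ "range (\<lambda>n::nat. {..<real n})"])
       (use reals_Archimedean2 assms in \<open>auto simp: emeasure_radial_measure_lessThan\<close>)
qed

text \<open>Dilation by \<open>r\<close> reduces the truncated cone to radius 1, where its volume is
  by construction the spherical mass of \<open>A\<close> times the volume of the unit ball.\<close>

lemma emeasure_lborel_cone:
  fixes A :: "'a::euclidean_space set"
  assumes [measurable]: "A \<in> sets borel" and r: "0 < r"
  shows "emeasure lborel {x. sgn x \<in> A \<and> norm x < r} =
     emeasure sphere_measure A * ennreal (unit_ball_vol DIM('a) * r ^ DIM('a))"
proof -
  let ?S = "\<lambda>r. {x::'a. sgn x \<in> A \<and> norm x < r}"
  have [measurable]: "?S r \<in> sets borel" for r by measurable
  have "emeasure lborel (?S r) = (\<integral>\<^sup>+x. indicator (?S r) x \<partial>density (distr lborel borel (\<lambda>x. 0 + r *\<^sub>R x)) (\<lambda>_. \<bar>r\<bar>^DIM('a)))"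
    using r by (subst lborel_affine[of r 0, symmetric]) simp_all
  also have "\<dots> = ennreal (r ^ DIM('a)) * (\<integral>\<^sup>+x. indicator (?S r) (r *\<^sub>R x) \<partial>lborel)"
    using r by (simp add: nn_integral_density nn_integral_distr nn_integral_cmult del: nn_integral_indicator)
  also have "(\<integral>\<^sup>+x. indicator (?S r) (r *\<^sub>R x) \<partial>lborel) = (\<integral>\<^sup>+x. indicator A (sgn x) * indicator (ball 0 1) x \<partial>lborel)"
    using r by (intro nn_integral_cong) (auto simp: sgn_scaleR split: split_indicator)
  also have "\<dots> = emeasure sphere_measure A * emeasure lborel (ball (0::'a) 1)"
    using emeasure_unit_ball_nontriv[where 'a='a] nn_integral_sphere_measure[of "indicator A"]
    by (simp add: ennreal_divide_times ennreal_divide_self less_top)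
  finally show ?thesis using r
    by (simp add: emeasure_ball ennreal_mult' mult_ac)
qed

text \<open>With \<open>A\<close> fixed, both sides are measures in the radial set, and they agree
  on the half-lines \<open>{..<r}\<close> by the cone formula; half-lines are closed under
  intersection and generate the Borel sets. The density in \<open>radial_measure\<close> is the
  surface area of the sphere of radius \<open>r\<close>.\<close>

lemma distr_lborel_polar:
  "distr lborel (borel \<Otimes>\<^sub>M borel) (\<lambda>x. (sgn x, norm x)) =
     (sphere_measure :: 'a::euclidean_space measure) \<Otimes>\<^sub>M radial_measure DIM('a)"
proof -
  let ?n = "DIM('a)"
  show ?thesis
  proof (rule pair_measure_eqI[symmetric])
    show "sigma_finite_measure (sphere_measure :: 'a measure)"
      by (rule sphere.sigma_finite_measure_axioms)
    show "sigma_finite_measure (radial_measure ?n)"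
      by (rule sigma_finite_radial_measure) simp
    show "sets (sphere_measure \<Otimes>\<^sub>M radial_measure ?n) =
      sets (distr lborel (borel \<Otimes>\<^sub>M borel) (\<lambda>x::'a. (sgn x, norm x)))"
      by (simp cong: sets_pair_measure_cong)
    fix A :: "'a set" and B assume "A \<in> sets sphere_measure" "B \<in> sets (radial_measure ?n)"
    then have [measurable]: "A \<in> sets borel" "B \<in> sets borel" by auto
    define M1 where "M1 = distr (density lborel (\<lambda>x. indicator A (sgn x))) borel norm"
    define M2 where "M2 = scale_measure (emeasure sphere_measure A) (radial_measure ?n)"
    have M1: "emeasure M1 C = emeasure lborel {x::'a. sgn x \<in> A \<and> norm x \<in> C}"
      if [measurable]: "C \<in> sets borel" for C
    proof -
      have [measurable]: "norm -` C \<in> sets (borel :: 'a measure)"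
        by (rule measurable_sets_borel[OF borel_measurable_norm]) auto
      have "emeasure M1 C = (\<integral>\<^sup>+x. indicator A (sgn x) * indicator (norm -` C) (x::'a) \<partial>lborel)"
        by (simp add: M1_def emeasure_distr emeasure_density)
      also have "\<dots> = (\<integral>\<^sup>+x. indicator {x::'a. sgn x \<in> A \<and> norm x \<in> C} x \<partial>lborel)"
        by (intro nn_integral_cong) (auto split: split_indicator)
      finally show ?thesis by simp
    qed
    have M12: "emeasure M1 {..<r} = emeasure M2 {..<r}" for r
    proof (cases "0 < r")
      case True
      then show ?thesis
        by (simp add: M1 M2_def emeasure_lborel_cone emeasure_radial_measure_lessThan)
    next
      case False
      then have empty: "{x::'a. sgn x \<in> A \<and> norm x \<in> {..<r}} = {}"
        by (auto simp: not_less intro: order_trans[OF _ norm_ge_zero])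
      have "emeasure M1 {..<r} = 0"
        unfolding M1[OF borel_open[OF open_lessThan]] empty by simp
      with False show ?thesis
        by (simp add: M2_def emeasure_radial_measure_lessThan)
    qed
    have "M1 = M2"
    proof (rule measure_eqI_generator_eq[where E = "range lessThan" and \<Omega> = UNIV and A = "\<lambda>n. {..<real n}"])
      show "Int_stable (range (lessThan :: real \<Rightarrow> _))"
      proof -
        have "{..<a} \<inter> {..<b} = {..<min a b}" for a b :: real by auto
        then show ?thesis by (auto simp: Int_stable_def)
      qed
      show "sets M1 = sigma_sets UNIV (range lessThan)" "sets M2 = sigma_sets UNIV (range lessThan)"
        by (simp_all add: M1_def M2_def borel_Iio)
      show "(\<Union>n. {..<real n}) = UNIV" using reals_Archimedean2 by auto
      show "emeasure M1 {..<real n} \<noteq> \<infinity>" for n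
      proof -
        have "emeasure M1 {..<real n} \<le> emeasure lborel (ball (0::'a) (real n))"
          unfolding M1[OF borel_open[OF open_lessThan]] by (intro emeasure_mono) auto
        then show ?thesis using emeasure_lborel_ball_finite[of "0::'a" "real n"] by (auto simp: top_unique)
      qed
    qed (auto simp: M12)
    then have "emeasure M2 B = emeasure M1 B" by simp
    also have "\<dots> = emeasure (distr lborel (borel \<Otimes>\<^sub>M borel) (\<lambda>x::'a. (sgn x, norm x))) (A \<times> B)"
      by (subst emeasure_distr) (auto simp: M1 intro!: arg_cong[where f = "emeasure lborel"])
    finally show "emeasure sphere_measure A * emeasure (radial_measure ?n) B =
        emeasure (distr lborel (borel \<Otimes>\<^sub>M borel) (\<lambda>x::'a. (sgn x, norm x))) (A \<times> B)"
      by (simp add: M2_def)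
  qed
qed

lemma nn_integral_lborel_polar:
  fixes h :: "'a::euclidean_space \<Rightarrow> real \<Rightarrow> ennreal"
  assumes [measurable]: "case_prod h \<in> borel_measurable (borel \<Otimes>\<^sub>M borel)"
  shows "(\<integral>\<^sup>+x. h (sgn x) (norm x) \<partial>lborel) =
    (\<integral>\<^sup>+u. \<integral>\<^sup>+r. ennreal (real DIM('a) * unit_ball_vol DIM('a) * r ^ (DIM('a) - 1)) * indicator {0..} r * h u r
      \<partial>lborel \<partial>sphere_measure)"
proof -
  interpret R: sigma_finite_measure "radial_measure DIM('a)"
    by (rule sigma_finite_radial_measure) simp
  have "(\<integral>\<^sup>+x. h (sgn x) (norm x) \<partial>lborel) =
     (\<integral>\<^sup>+z. case_prod h z \<partial>distr lborel (borel \<Otimes>\<^sub>M borel) (\<lambda>x::'a. (sgn x, norm x)))"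
    by (subst nn_integral_distr) auto
  also have "\<dots> = (\<integral>\<^sup>+u. \<integral>\<^sup>+r. h u r \<partial>radial_measure DIM('a) \<partial>sphere_measure)"
    unfolding distr_lborel_polar by (subst R.nn_integral_fst[symmetric]) auto
  finally show ?thesis
    by (simp add: radial_measure_def nn_integral_density)
qed

subsection \<open>Marginals of the uniform measure on a sphere\<close>

text \<open>This is the passage from tangent to sine: \<open>w = tan a\<close> and
  \<open>t = sin a\<close>. The images of the intervals \<open>{0..real n}\<close> exhaust
  \<open>{0..<1}\<close>, so the substitution is done on compact intervals and monotone convergence
  yields the half-line.\<close>

lemma nn_integral_substitution_div_sqrt:
  fixes h :: "real \<Rightarrow> ennreal"
  assumes [measurable]: "h \<in> borel_measurable borel"
  shows "(\<integral>\<^sup>+t. h t * indicator {0..<1} t \<partial>lborel) =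
    (\<integral>\<^sup>+w. h (w / sqrt (1 + w\<^sup>2)) * ennreal ((1 / sqrt (1 + w\<^sup>2)) ^ 3) * indicator {0..} w \<partial>lborel)"
proof -
  define g where "g w = w / sqrt (1 + w\<^sup>2)" for w :: real
  define g' where "g' w = (1 / sqrt (1 + w\<^sup>2)) ^ 3" for w :: real
  have pos: "0 < 1 + w\<^sup>2" for w :: real by (simp add: add_pos_nonneg)
  have deriv: "(g has_real_derivative g' w) (at w)" for w
  proof -
    have "sqrt (1 + w\<^sup>2) * sqrt (1 + w\<^sup>2) = 1 + w\<^sup>2" using pos[of w] by simp
    moreover have "sqrt (1 + w\<^sup>2) > 0" using pos by simp
    ultimately show ?thesis
      unfolding g_def g'_def using pos[of w]
      by (auto intro!: derivative_eq_intros simp: field_simps power2_eq_square power3_eq_cube)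
  qed
  have contg': "continuous_on A g'" for A
    unfolding g'_def using pos by (intro continuous_intros) (auto simp: less_imp_neq[symmetric])
  have [measurable]: "g \<in> borel_measurable borel" "g' \<in> borel_measurable borel"
    unfolding g_def g'_def by measurable
  have g_mono: "g a < g b" if "a < b" for a b
    using that by (rule DERIV_pos_imp_increasing) (use deriv pos in \<open>auto simp: g'_def intro!: exI\<close>)
  have g_less: "g w < 1" for w
  proof -
    have "w \<le> sqrt (w\<^sup>2)" by simp
    also have "\<dots> < sqrt (1 + w\<^sup>2)" by (rule real_sqrt_less_mono) simp
    finally show ?thesis using pos[of w] by (simp add: g_def)
  qed
  have g_inv: "g (t / sqrt (1 - t\<^sup>2)) = t" if "0 \<le> t" "t < 1" for t
  proof -
    have t: "t\<^sup>2 < 1" using that by (simp add: power_less_one_iff)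
    then have "1 + (t / sqrt (1 - t\<^sup>2))\<^sup>2 = 1 / (1 - t\<^sup>2)"
      by (simp add: power_divide field_simps)
    with t show ?thesis by (simp add: g_def real_sqrt_divide)
  qed
  have "(\<integral>\<^sup>+t. h t * indicator {0..<1} t \<partial>lborel) = (\<integral>\<^sup>+t. (SUP n. h t * indicator {0..g (real n)} t) \<partial>lborel)"
  proof (rule nn_integral_cong)
    fix t :: real
    show "h t * indicator {0..<1} t = (SUP n. h t * indicator {0..g (real n)} t)"
    proof (cases "0 \<le> t \<and> t < 1")
      case True
      obtain n where n: "t / sqrt (1 - t\<^sup>2) < real n" using reals_Archimedean2 by blast
      then have "t \<le> g (real n)" using g_mono[OF n] g_inv[of t] True by simp
      then have "h t * indicator {0..g (real n)} t = h t" using True by simp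
      then show ?thesis using True
        by (intro antisym SUP_least) (auto intro!: SUP_upper2[of n] split: split_indicator)
    next
      case False
      then have "indicator {0..g (real n)} t = (0::ennreal)" for n
        using g_less[of "real n"] by (auto split: split_indicator)
      with False show ?thesis by (auto split: split_indicator)
    qed
  qed
  also have "\<dots> = (SUP n. \<integral>\<^sup>+t. h t * indicator {0..g (real n)} t \<partial>lborel)"
  proof (rule nn_integral_monotone_convergence_SUP)
    show "incseq (\<lambda>n t. h t * indicator {0..g (real n)} t)"
    proof (intro incseq_SucI le_funI mult_left_mono)
      fix n t
      have "g (real n) < g (real (Suc n))" by (intro g_mono) simp
      then show "indicator {0..g (real n)} t \<le> (indicator {0..g (real (Suc n))} t :: ennreal)"
        by (auto split: split_indicator)
    qed simp
  qed measurable
  also have "(\<lambda>n. \<integral>\<^sup>+t. h t * indicator {0..g (real n)} t \<partial>lborel) =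
    (\<lambda>n. \<integral>\<^sup>+w. h (g w) * ennreal (g' w) * indicator {0..real n} w \<partial>lborel)"
  proof
    fix n :: nat
    have g0: "g 0 = 0" by (simp add: g_def)
    show "(\<integral>\<^sup>+t. h t * indicator {0..g (real n)} t \<partial>lborel) =
       (\<integral>\<^sup>+w. h (g w) * ennreal (g' w) * indicator {0..real n} w \<partial>lborel)"
    \<comment> \<open>For \<open>n = 0\<close> the interval is a single point, which is a null set;
      the substitution rule is applied to nondegenerate intervals only.\<close>
    proof (cases "n = 0")
      case True
      have zero: "(\<integral>\<^sup>+w. k w * indicator {0} w \<partial>lborel) = 0" for k :: "real \<Rightarrow> ennreal"
      proof -
        have "(\<integral>\<^sup>+w. k w * indicator {0} w \<partial>lborel) = (\<integral>\<^sup>+w. 0 \<partial>(lborel :: real measure))"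
          by (rule nn_integral_cong_AE, use AE_lborel_singleton[of "0::real"] in eventually_elim) simp
        then show ?thesis by simp
      qed
      show ?thesis using True by (simp add: g0 zero)
    next
      case False
      then show ?thesis
        using nn_integral_substitution_aux[of h 0 "real n" g g'] deriv contg'
        by (simp add: g0) (simp add: g'_def)
    qed
  qed
  also have "(SUP n. \<integral>\<^sup>+w. h (g w) * ennreal (g' w) * indicator {0..real n} w \<partial>lborel) =
     (\<integral>\<^sup>+w. (SUP n. h (g w) * ennreal (g' w) * indicator {0..real n} w) \<partial>lborel)"
  proof (rule nn_integral_monotone_convergence_SUP[symmetric])
    show "incseq (\<lambda>n w. h (g w) * ennreal (g' w) * indicator {0..real n} w)"
      by (intro incseq_SucI le_funI mult_left_mono) (auto split: split_indicator)
  qed measurable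
  also have "\<dots> = (\<integral>\<^sup>+w. h (g w) * ennreal (g' w) * indicator {0..} w \<partial>lborel)"
  proof (rule nn_integral_cong)
    fix w :: real
    obtain n where n: "w < real n" using reals_Archimedean2 by blast
    show "(SUP n. h (g w) * ennreal (g' w) * indicator {0..real n} w) = h (g w) * ennreal (g' w) * indicator {0..} w"
      using n by (intro antisym SUP_least) (auto intro!: SUP_upper2[of n] split: split_indicator)
  qed
  finally show ?thesis unfolding g_def g'_def .
qed

text \<open>Here \<open>r\<close> and \<open>\<rho>\<close> are the lengths of the two components of
  a vector in the unit ball, and \<open>f\<close> sees only their ratio. In the slope coordinate
  \<open>w = r / \<rho>\<close> the variable \<open>\<rho>\<close> runs up to \<open>1 / s w\<close>
  and can be integrated out, which produces the denominator \<open>real (p + q)\<close>; then slope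
  is converted to \<open>t\<close>.\<close>

lemma nn_integral_quadrant_angle:
  fixes f :: "real \<Rightarrow> ennreal" and p q :: nat and \<alpha> \<beta> :: real
  assumes [measurable]: "f \<in> borel_measurable borel"
    and p: "1 \<le> p" and q: "2 \<le> q" and \<alpha>: "0 \<le> \<alpha>" and \<beta>: "0 \<le> \<beta>"
  shows "(\<integral>\<^sup>+r. ennreal (\<alpha> * r ^ (p - 1)) * indicator {0..} r *
       (\<integral>\<^sup>+\<rho>. ennreal (\<beta> * \<rho> ^ (q - 1)) * indicator {0..} \<rho> *
          (f (r / sqrt (r\<^sup>2 + \<rho>\<^sup>2)) * indicator {..<1} (sqrt (r\<^sup>2 + \<rho>\<^sup>2))) \<partial>lborel) \<partial>lborel) =
    (\<integral>\<^sup>+t. ennreal (\<alpha> * \<beta> / real (p + q) * t ^ (p - 1) * sqrt (1 - t\<^sup>2) ^ (q - 2)) * indicator {0..<1} t * f t \<partial>lborel)"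
proof -
  define s where "s w = sqrt (1 + w\<^sup>2)" for w :: real
  have [measurable]: "s \<in> borel_measurable borel" unfolding s_def by measurable
  have s_pos: "s w > 0" for w by (simp add: s_def add_pos_nonneg)
  have s2: "(s w)\<^sup>2 = 1 + w\<^sup>2" for w by (simp add: s_def)
  have scale: "sqrt ((\<rho> * w)\<^sup>2 + \<rho>\<^sup>2) = \<rho> * s w" if "0 \<le> \<rho>" for \<rho> w
  proof -
    have "(\<rho> * w)\<^sup>2 + \<rho>\<^sup>2 = \<rho>\<^sup>2 * (1 + w\<^sup>2)" by (simp add: power_mult_distrib algebra_simps)
    then show ?thesis using that by (simp add: s_def real_sqrt_mult)
  qed
  let ?L = "\<lambda>r \<rho>. ennreal (\<alpha> * r ^ (p - 1)) * indicator {0..} r * (ennreal (\<beta> * \<rho> ^ (q - 1)) * indicator {0..} \<rho> *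
          (f (r / sqrt (r\<^sup>2 + \<rho>\<^sup>2)) * indicator {..<1} (sqrt (r\<^sup>2 + \<rho>\<^sup>2))))"
  let ?R = "\<lambda>w \<rho>. ennreal (\<alpha> * \<beta> * w ^ (p - 1)) * indicator {0..} w * f (w / s w) *
          (ennreal (\<rho> ^ (p + q - 1)) * indicator {0..1 / s w} \<rho>)"
  have [measurable]: "Measurable.pred (borel \<Otimes>\<^sub>M borel) (\<lambda>x. snd x \<in> {0..1 / s (fst x)})"
    unfolding atLeastAtMost_iff by measurable
  have "(\<integral>\<^sup>+r. ennreal (\<alpha> * r ^ (p - 1)) * indicator {0..} r *
       (\<integral>\<^sup>+\<rho>. ennreal (\<beta> * \<rho> ^ (q - 1)) * indicator {0..} \<rho> *
          (f (r / sqrt (r\<^sup>2 + \<rho>\<^sup>2)) * indicator {..<1} (sqrt (r\<^sup>2 + \<rho>\<^sup>2))) \<partial>lborel) \<partial>lborel)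
     = (\<integral>\<^sup>+r. \<integral>\<^sup>+\<rho>. ?L r \<rho> \<partial>lborel \<partial>lborel)"
    by (subst nn_integral_cmult[symmetric]) auto
  also have "\<dots> = (\<integral>\<^sup>+\<rho>. \<integral>\<^sup>+r. ?L r \<rho> \<partial>lborel \<partial>lborel)"
    by (rule lborel_pair.Fubini'[symmetric]) measurable
  also have "\<dots> = (\<integral>\<^sup>+\<rho>. \<integral>\<^sup>+w. ?R w \<rho> \<partial>lborel \<partial>lborel)"
  proof (rule nn_integral_cong_AE)
    show "AE \<rho> in lborel. (\<integral>\<^sup>+r. ?L r \<rho> \<partial>lborel) = (\<integral>\<^sup>+w. ?R w \<rho> \<partial>lborel)"
      using AE_lborel_singleton[of "0::real"]
    proof eventually_elim
      fix \<rho> :: real assume "\<rho> \<noteq> 0"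
      show "(\<integral>\<^sup>+r. ?L r \<rho> \<partial>lborel) = (\<integral>\<^sup>+w. ?R w \<rho> \<partial>lborel)"
      proof (cases "0 < \<rho>")
        case False
        with \<open>\<rho> \<noteq> 0\<close> show ?thesis by (auto simp: indicator_def)
      next
        case True
        have "(\<integral>\<^sup>+r. ?L r \<rho> \<partial>lborel) = ennreal \<rho> * (\<integral>\<^sup>+w. ?L (0 + \<rho> * w) \<rho> \<partial>lborel)"
          using True by (subst nn_integral_real_affine[of _ \<rho> 0]) auto
        also have "\<dots> = (\<integral>\<^sup>+w. ennreal \<rho> * ?L (\<rho> * w) \<rho> \<partial>lborel)"
          by (subst nn_integral_cmult) auto
        also have "\<dots> = (\<integral>\<^sup>+w. ?R w \<rho> \<partial>lborel)"
        proof (rule nn_integral_cong_AE)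
          \<comment> \<open>The strict and the closed indicator differ only where
            \<open>\<rho> * s w = 1\<close>, on the unit circle, hence at two values of
            \<open>w\<close> at most.\<close>
          have "AE w in lborel. w \<noteq> sqrt (1 / \<rho>\<^sup>2 - 1) \<and> w \<noteq> - sqrt (1 / \<rho>\<^sup>2 - 1)"
            using AE_lborel_singleton[of "sqrt (1 / \<rho>\<^sup>2 - 1)"] AE_lborel_singleton[of "- sqrt (1 / \<rho>\<^sup>2 - 1)"]
            by eventually_elim auto
          then show "AE w in lborel. ennreal \<rho> * ?L (\<rho> * w) \<rho> = ?R w \<rho>"
          proof eventually_elim
            fix w :: real assume w: "w \<noteq> sqrt (1 / \<rho>\<^sup>2 - 1) \<and> w \<noteq> - sqrt (1 / \<rho>\<^sup>2 - 1)"
            have ne: "\<rho> * s w \<noteq> 1"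
            proof
              assume "\<rho> * s w = 1"
              then have "\<rho>\<^sup>2 * (s w)\<^sup>2 = 1" by (metis power_mult_distrib power_one)
              then have "w\<^sup>2 = 1 / \<rho>\<^sup>2 - 1" using True by (simp add: s2 field_simps)
              then have "\<bar>w\<bar> = sqrt (1 / \<rho>\<^sup>2 - 1)" by (metis real_sqrt_abs)
              with w show False by linarith
            qed
            have ind: "indicator {..<1} (\<rho> * s w) = (indicator {0..1 / s w} \<rho> :: ennreal)"
              using True s_pos[of w] ne by (auto simp: field_simps split: split_indicator)
            have quot: "\<rho> * w / (\<rho> * s w) = w / s w" using True by simp
            show "ennreal \<rho> * ?L (\<rho> * w) \<rho> = ?R w \<rho>"
            proof (cases "0 \<le> w")
              case False
              then have "\<not> 0 \<le> \<rho> * w" using True by (simp add: zero_le_mult_iff)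
              with False show ?thesis by simp
            next
              case w0: True
              have pq: "p + q - 1 = Suc ((p - 1) + (q - 1))" using p q by simp
              have "ennreal \<rho> * (ennreal (\<alpha> * (\<rho> * w) ^ (p - 1)) * ennreal (\<beta> * \<rho> ^ (q - 1)))
                = ennreal (\<alpha> * \<beta> * w ^ (p - 1)) * ennreal (\<rho> ^ (p + q - 1))"
                unfolding pq using True w0 \<alpha> \<beta>
                by (simp add: ennreal_mult'[symmetric] power_mult_distrib power_add mult_ac)
              note coeff = this
              have "ennreal \<rho> * ?L (\<rho> * w) \<rho> = (ennreal \<rho> * (ennreal (\<alpha> * (\<rho> * w) ^ (p - 1)) * ennreal (\<beta> * \<rho> ^ (q - 1)))) *
                  (f (w / s w) * indicator {0..1 / s w} \<rho>)"
                unfolding scale[OF less_imp_le[OF True]] ind quot using True w0 by (simp add: mult.assoc)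
              also have "\<dots> = ?R w \<rho>"
                unfolding coeff using w0 by (simp add: mult_ac)
              finally show ?thesis .
            qed
          qed
        qed
        finally show ?thesis .
      qed
    qed
  qed
  also have "\<dots> = (\<integral>\<^sup>+w. \<integral>\<^sup>+\<rho>. ?R w \<rho> \<partial>lborel \<partial>lborel)"
    by (rule lborel_pair.Fubini') measurable
  also have "\<dots> = (\<integral>\<^sup>+w. ennreal (\<alpha> * \<beta> * w ^ (p - 1)) * indicator {0..} w * f (w / s w) *
      ennreal ((1 / s w) ^ (p + q) / real (p + q)) \<partial>lborel)"
  proof (rule nn_integral_cong)
    fix w
    have deriv: "((\<lambda>x. x ^ m / real m) has_real_derivative x ^ (m - 1)) (at x)" if "0 < m" for m x
      using that by (auto intro!: derivative_eq_intros)
    have "(\<integral>\<^sup>+\<rho>. ennreal (\<rho> ^ (p + q - 1)) * indicator {0..1 / s w} \<rho> \<partial>lborel) =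
       ennreal ((1 / s w) ^ (p + q) / real (p + q) - 0 ^ (p + q) / real (p + q))"
      using p s_pos[of w] by (intro nn_integral_FTC_Icc deriv) auto
    then show "(\<integral>\<^sup>+\<rho>. ?R w \<rho> \<partial>lborel) = ennreal (\<alpha> * \<beta> * w ^ (p - 1)) * indicator {0..} w * f (w / s w) *
      ennreal ((1 / s w) ^ (p + q) / real (p + q))"
      using p by (subst nn_integral_cmult) (auto simp: zero_power)
  qed
  also have "\<dots> = (\<integral>\<^sup>+w. (ennreal (\<alpha> * \<beta> / real (p + q) * (w / s w) ^ (p - 1) * sqrt (1 - (w / s w)\<^sup>2) ^ (q - 2)) * f (w / s w))
       * ennreal ((1 / s w) ^ 3) * indicator {0..} w \<partial>lborel)"
  proof (rule nn_integral_cong)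
    fix w
    show "ennreal (\<alpha> * \<beta> * w ^ (p - 1)) * indicator {0..} w * f (w / s w) *
      ennreal ((1 / s w) ^ (p + q) / real (p + q)) = (ennreal (\<alpha> * \<beta> / real (p + q) * (w / s w) ^ (p - 1) * sqrt (1 - (w / s w)\<^sup>2) ^ (q - 2)) * f (w / s w))
       * ennreal ((1 / s w) ^ 3) * indicator {0..} w"
    proof (cases "0 \<le> w")
      case True
      have "1 - (w / s w)\<^sup>2 = (1 / s w)\<^sup>2"
      proof -
        have "1 + w\<^sup>2 \<noteq> 0" by (metis s2 s_pos less_numeral_extra(3) zero_less_power)
        then show ?thesis by (simp add: power_divide s2 divide_simps)
      qed
      then have sq: "sqrt (1 - (w / s w)\<^sup>2) = 1 / s w" using s_pos[of w] by simp
      \<comment> \<open>Of the \<open>p + q\<close> powers of \<open>1 / s w\<close>,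
        \<open>p - 1\<close> turn \<open>w\<close> into \<open>t\<close>, \<open>q - 2\<close>
        become the power of \<open>sqrt (1 - t\<^sup>2)\<close>, and 3 are the Jacobian of
        \<open>t = w / s w\<close>.\<close>
      have pq: "p + q = (p - 1) + (q - 2) + 3" using p q by simp
      have pw: "(1 / s w) ^ (p + q) = (1 / s w) ^ (p - 1) * (1 / s w) ^ (q - 2) * (1 / s w) ^ 3"
        by (subst pq) (simp only: power_add)
      have "\<alpha> * \<beta> * w ^ (p - 1) * ((1 / s w) ^ (p + q) / real (p + q)) =
        (\<alpha> * \<beta> / real (p + q) * (w / s w) ^ (p - 1) * (1 / s w) ^ (q - 2)) * (1 / s w) ^ 3"
        unfolding pw by (simp add: power_divide)
      then have "ennreal (\<alpha> * \<beta> * w ^ (p - 1)) * ennreal ((1 / s w) ^ (p + q) / real (p + q)) =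
        ennreal (\<alpha> * \<beta> / real (p + q) * (w / s w) ^ (p - 1) * (1 / s w) ^ (q - 2)) * ennreal ((1 / s w) ^ 3)"
        using True \<alpha> \<beta> s_pos[of w] by (simp add: ennreal_mult[symmetric] del: power_divide power_one_over)
      note coeff = this
      have "ennreal (\<alpha> * \<beta> * w ^ (p - 1)) * indicator {0..} w * f (w / s w) * ennreal ((1 / s w) ^ (p + q) / real (p + q)) =
        (ennreal (\<alpha> * \<beta> * w ^ (p - 1)) * ennreal ((1 / s w) ^ (p + q) / real (p + q))) * f (w / s w)"
        using True by (simp only: indicator_simps atLeast_iff mult_ac mult_1_right mult_1_left)
      then show ?thesis unfolding sq coeff using True
        by (simp only: indicator_simps atLeast_iff mult_ac mult_1_right mult_1_left)
    qed simp
  qed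
  also have "\<dots> = (\<integral>\<^sup>+t. (ennreal (\<alpha> * \<beta> / real (p + q) * t ^ (p - 1) * sqrt (1 - t\<^sup>2) ^ (q - 2)) * f t) * indicator {0..<1} t \<partial>lborel)"
    unfolding s_def by (rule nn_integral_substitution_div_sqrt[symmetric]) measurable
  finally show ?thesis by (simp add: mult_ac)
qed


text \<open>Polar coordinates in each factor separate the direction of \<open>fst z\<close> from the
  two lengths, and the quadrant integral handles the lengths. In probabilistic terms the direction
  is uniform and independent of the length \<open>t\<close>, and \<open>t\<^sup>2\<close> has the
  Beta law whose parameters are half the two dimensions. \<open>C\<close> is the product of the two
  sphere areas divided by the area of the sphere in the product space.\<close>

theorem nn_integral_sphere_measure_fst:
  fixes F :: "'a::euclidean_space \<Rightarrow> real \<Rightarrow> ennreal"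
  assumes [measurable]: "case_prod F \<in> borel_measurable (borel \<Otimes>\<^sub>M borel)"
    and q: "2 \<le> DIM('b::euclidean_space)"
  defines "C \<equiv> real DIM('a) * unit_ball_vol DIM('a) * (real DIM('b) * unit_ball_vol DIM('b)) /
      (real (DIM('a) + DIM('b)) * unit_ball_vol (DIM('a) + DIM('b)))"
  shows "(\<integral>\<^sup>+z. F (sgn (fst z)) (norm (fst z)) \<partial>(sphere_measure :: ('a \<times> 'b) measure)) =
    (\<integral>\<^sup>+u. \<integral>\<^sup>+t. ennreal (C * t ^ (DIM('a) - 1) * sqrt (1 - t\<^sup>2) ^ (DIM('b) - 2)) * indicator {0..<1} t * F u t
       \<partial>lborel \<partial>sphere_measure)"
proof -
  define p q where "p = DIM('a)" and "q = DIM('b)"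
  let ?V = "emeasure lborel (ball (0::'a \<times> 'b) 1)"
  define \<alpha> \<beta> where "\<alpha> = real p * unit_ball_vol p" and "\<beta> = real q * unit_ball_vol q"
  have \<alpha>\<beta>: "0 \<le> \<alpha>" "0 \<le> \<beta>" by (simp_all add: \<alpha>_def \<beta>_def)
  let ?G = "\<lambda>u r. (\<integral>\<^sup>+\<rho>. ennreal (\<beta> * \<rho> ^ (q - 1)) * indicator {0..} \<rho> *
          (F u (r / sqrt (r\<^sup>2 + \<rho>\<^sup>2)) * indicator {..<1} (sqrt (r\<^sup>2 + \<rho>\<^sup>2))) \<partial>lborel)"
  have [measurable]: "(\<lambda>z. F (sgn (fst z)) (norm (fst z))) \<in> borel_measurable (borel :: ('a \<times> 'b) measure)"
    unfolding borel_prod[symmetric] by measurable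
  have sgn_fst: "sgn (fst (sgn z)) = sgn (fst z)" for z :: "'a \<times> 'b"
    by (cases "z = 0") (auto simp: sgn_div_norm)
  have norm_fst: "norm (fst (sgn z)) = norm (fst z) / norm z" for z :: "'a \<times> 'b"
    by (simp add: sgn_div_norm divide_inverse mult.commute)
  have "(\<integral>\<^sup>+z. F (sgn (fst z)) (norm (fst z)) \<partial>(sphere_measure :: ('a \<times> 'b) measure)) * ?V =
    (\<integral>\<^sup>+z. F (sgn (fst z)) (norm (fst z) / norm z) * indicator (ball (0::'a \<times> 'b) 1) z \<partial>lborel)"
    using emeasure_unit_ball_nontriv[where 'a="'a \<times> 'b"]
    by (simp add: nn_integral_sphere_measure sgn_fst norm_fst ennreal_divide_times ennreal_divide_self less_top)
  also have "\<dots> = (\<integral>\<^sup>+a. \<integral>\<^sup>+c. F (sgn a) (norm a / sqrt ((norm a)\<^sup>2 + (norm (c::'b))\<^sup>2)) *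
      indicator {..<1} (sqrt ((norm a)\<^sup>2 + (norm c)\<^sup>2)) \<partial>lborel \<partial>lborel)"
    (is "integral\<^sup>N lborel ?h = _")
  proof -
    have "?h \<in> borel_measurable borel"
      unfolding borel_prod[symmetric] by measurable (simp_all add: borel_prod)
    then have "?h \<in> borel_measurable (lborel \<Otimes>\<^sub>M lborel)"
      by (simp add: lborel_prod)
    note fst = lborel.nn_integral_fst[OF this, unfolded lborel_prod]
    show ?thesis
      by (subst fst[symmetric]) (auto simp: norm_Pair intro!: nn_integral_cong split: split_indicator)
  qed
  also have "\<dots> = (\<integral>\<^sup>+a. ?G (sgn a) (norm a) \<partial>lborel)"
  proof (rule nn_integral_cong)
    fix a :: 'a
    show "(\<integral>\<^sup>+c. F (sgn a) (norm a / sqrt ((norm a)\<^sup>2 + (norm (c::'b))\<^sup>2)) *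
      indicator {..<1} (sqrt ((norm a)\<^sup>2 + (norm c)\<^sup>2)) \<partial>lborel) = ?G (sgn a) (norm a)"
      using nn_integral_lborel_polar[of "\<lambda>(_::'b) r. F (sgn a) (norm a / sqrt ((norm a)\<^sup>2 + r\<^sup>2)) *
      indicator {..<1} (sqrt ((norm a)\<^sup>2 + r\<^sup>2))"]
      by (simp add: \<beta>_def q_def sphere.emeasure_space_1[simplified])
  qed
  also have "\<dots> = (\<integral>\<^sup>+u. \<integral>\<^sup>+r. ennreal (\<alpha> * r ^ (p - 1)) * indicator {0..} r * ?G u r \<partial>lborel \<partial>sphere_measure)"
    unfolding \<alpha>_def p_def by (rule nn_integral_lborel_polar) measurable
  also have "\<dots> = (\<integral>\<^sup>+u. \<integral>\<^sup>+t. ennreal (\<alpha> * \<beta> / real (p + q) * t ^ (p - 1) * sqrt (1 - t\<^sup>2) ^ (q - 2)) * indicator {0..<1} t * F u t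
      \<partial>lborel \<partial>sphere_measure)"
    using \<alpha>\<beta> q DIM_positive[where 'a='a]
    by (intro nn_integral_cong nn_integral_quadrant_angle) (auto simp: p_def q_def Suc_le_eq)
  also have "\<dots> = (\<integral>\<^sup>+u. \<integral>\<^sup>+t. ennreal (C * t ^ (p - 1) * sqrt (1 - t\<^sup>2) ^ (q - 2)) * indicator {0..<1} t * F u t
      \<partial>lborel \<partial>sphere_measure) * ?V"
  proof -
    have V: "?V = ennreal (unit_ball_vol (p + q))" "0 < unit_ball_vol (p + q)"
      by (simp_all add: emeasure_ball p_def q_def)
    have "unit_ball_vol (real DIM('a) + real DIM('b)) \<noteq> 0"
      by (rule less_imp_neq[symmetric]) (simp add: unit_ball_vol_pos)
    then have C: "\<alpha> * \<beta> / real (p + q) = unit_ball_vol (p + q) * C" "0 \<le> C"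
      unfolding C_def \<alpha>_def \<beta>_def p_def q_def by auto
    let ?W = "\<lambda>u t. ennreal (C * t ^ (p - 1) * sqrt (1 - t\<^sup>2) ^ (q - 2)) * indicator {0..<1} t * F u t"
    have "ennreal (\<alpha> * \<beta> / real (p + q) * t ^ (p - 1) * sqrt (1 - t\<^sup>2) ^ (q - 2)) * indicator {0..<1} t * F u t =
       ?V * ?W u t" for u t
      unfolding V C(1) using V(2) C(2)
      by (simp add: ennreal_mult' mult.assoc split: split_indicator)
    then have "(\<integral>\<^sup>+u. \<integral>\<^sup>+t. ennreal (\<alpha> * \<beta> / real (p + q) * t ^ (p - 1) * sqrt (1 - t\<^sup>2) ^ (q - 2)) * indicator {0..<1} t * F u t
      \<partial>lborel \<partial>sphere_measure) = (\<integral>\<^sup>+u. \<integral>\<^sup>+t. ?V * ?W u t \<partial>lborel \<partial>sphere_measure)"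
      by simp
    also have "\<dots> = (\<integral>\<^sup>+u. ?V * (\<integral>\<^sup>+t. ?W u t \<partial>lborel) \<partial>sphere_measure)"
      by (intro nn_integral_cong nn_integral_cmult) measurable
    also have "\<dots> = ?V * (\<integral>\<^sup>+u. \<integral>\<^sup>+t. ?W u t \<partial>lborel \<partial>sphere_measure)"
      by (rule nn_integral_cmult) measurable
    finally show ?thesis by (simp only: mult.commute)
  qed
  finally show ?thesis
    using emeasure_unit_ball_nontriv[where 'a="'a \<times> 'b"]
    unfolding p_def[symmetric] q_def[symmetric] mult.commute[of _ ?V]
    by (simp only: ennreal_mult_cancel_left) auto
qed

subsection \<open>Uniqueness of Haar measure\<close>

lemma cadj_cadj [simp]: "cadj (cadj A) = A"
  by (simp add: cadj_def vec_eq_iff)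

lemma cadj_mult: "cadj (A ** B) = cadj B ** cadj A"
  by (simp add: cadj_def matrix_matrix_mult_def vec_eq_iff mult.commute)

lemma continuous_on_cadj [continuous_intros]:
  "continuous_on S f \<Longrightarrow> continuous_on S (\<lambda>x. cadj (f x))"
  unfolding cadj_def by (intro continuous_intros)

lemma continuous_on_matrix_mult [continuous_intros]:
  fixes f g :: "'a::topological_space \<Rightarrow> complex^'n^'n"
  shows "continuous_on S f \<Longrightarrow> continuous_on S g \<Longrightarrow> continuous_on S (\<lambda>x. f x ** g x)"
  unfolding matrix_matrix_mult_def by (intro continuous_intros)

lemma measurable_cadj [measurable]: "cadj \<in> borel_measurable borel"
  by (intro borel_measurable_continuous_onI continuous_intros)

lemma measurable_matrix_mult [measurable (raw)]:
  fixes f g :: "'a \<Rightarrow> complex^'n^'n"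
  assumes [measurable]: "f \<in> borel_measurable M" "g \<in> borel_measurable M"
  shows "(\<lambda>x. f x ** g x) \<in> borel_measurable M"
proof -
  have "(\<lambda>p :: (complex^'n^'n) \<times> (complex^'n^'n). fst p ** snd p) \<in> borel_measurable borel"
    by (intro borel_measurable_continuous_onI continuous_intros)
  then have "(\<lambda>p :: (complex^'n^'n) \<times> (complex^'n^'n). fst p ** snd p) \<in> borel_measurable (borel \<Otimes>\<^sub>M borel)"
    by (simp add: borel_prod)
  from measurable_compose[OF _ this, of "\<lambda>x. (f x, g x)" M] show ?thesis by simp
qed

text \<open>Integrate \<open>f (cadj g ** h)\<close> over \<open>g\<close> in \<open>N\<close> and
  \<open>h\<close> in \<open>M\<close>. Left invariance of \<open>M\<close> removes
  \<open>g\<close>; with the argument written as \<open>cadj (cadj h ** g)\<close>, left invariance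
  of \<open>N\<close> removes \<open>h\<close>. Taking adjoints, which is inversion for unitary
  matrices, stands in for right invariance.\<close>

lemma is_haar_integral_cadj:
  fixes f :: "complex^'n^'n \<Rightarrow> ennreal"
  assumes G: "\<And>g. g \<in> G \<Longrightarrow> cadj g \<in> G"
    and M: "is_haar G M" and N: "is_haar G N"
    and [measurable]: "f \<in> borel_measurable borel"
  shows "(\<integral>\<^sup>+x. f x \<partial>M) = (\<integral>\<^sup>+x. f (cadj x) \<partial>N)"
proof -
  have setsM[measurable_cong]: "sets M = sets borel" and setsN[measurable_cong]: "sets N = sets borel"
    using M N by (auto simp: is_haar_def)
  interpret M: prob_space M using M by (simp add: is_haar_def)
  interpret N: prob_space N using N by (simp add: is_haar_def)
  interpret pair_sigma_finite N M ..
  \<comment> \<open>A non-measurable set has \<open>emeasure\<close> 0, so mass 1 already forces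
    \<open>G\<close> to be measurable.\<close>
  have meas_G: "G \<in> sets M" "G \<in> sets N"
    using M N emeasure_notin_sets[of G M] emeasure_notin_sets[of G N] by (auto simp: is_haar_def)
  have AE_M: "AE h in M. h \<in> G" and AE_N: "AE g in N. g \<in> G"
    using M N meas_G
    by (auto simp: is_haar_def M.AE_in_set_eq_1 N.AE_in_set_eq_1 M.emeasure_eq_measure N.emeasure_eq_measure)
  have inv: "(\<integral>\<^sup>+x. k (g ** x) \<partial>L) = (\<integral>\<^sup>+x. k x \<partial>L)"
    if "is_haar G L" "g \<in> G" and [measurable]: "k \<in> borel_measurable borel" for L g k
  proof -
    have [measurable_cong]: "sets L = sets borel" and L: "distr L borel (\<lambda>x. g ** x) = L"
      using that by (auto simp: is_haar_def)
    have "(\<integral>\<^sup>+x. k x \<partial>distr L borel (\<lambda>x. g ** x)) = (\<integral>\<^sup>+x. k (g ** x) \<partial>L)"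
      by (rule nn_integral_distr) measurable
    then show ?thesis unfolding L by simp
  qed
  have "(\<integral>\<^sup>+x. f x \<partial>M) = (\<integral>\<^sup>+g. (\<integral>\<^sup>+h. f h \<partial>M) \<partial>N)"
    by (simp add: N.emeasure_space_1)
  also have "\<dots> = (\<integral>\<^sup>+g. (\<integral>\<^sup>+h. f (cadj g ** h) \<partial>M) \<partial>N)"
    by (rule nn_integral_cong_AE, use AE_N in eventually_elim) (simp add: inv[OF M G])
  also have "\<dots> = (\<integral>\<^sup>+h. (\<integral>\<^sup>+g. f (cadj g ** h) \<partial>N) \<partial>M)"
    by (rule Fubini'[symmetric]) measurable
  also have "\<dots> = (\<integral>\<^sup>+h. (\<integral>\<^sup>+g. f (cadj (cadj h ** g)) \<partial>N) \<partial>M)"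
    by (simp add: cadj_mult)
  also have "\<dots> = (\<integral>\<^sup>+h. (\<integral>\<^sup>+g. f (cadj g) \<partial>N) \<partial>M)"
  proof (rule nn_integral_cong_AE, use AE_M in eventually_elim)
    fix h assume "h \<in> G"
    then show "(\<integral>\<^sup>+g. f (cadj (cadj h ** g)) \<partial>N) = (\<integral>\<^sup>+g. f (cadj g) \<partial>N)"
      by (intro inv[OF N G]) auto
  qed
  also have "\<dots> = (\<integral>\<^sup>+g. f (cadj g) \<partial>N)"
    by (simp add: M.emeasure_space_1)
  finally show ?thesis .
qed

text \<open>Integrals against \<open>N\<close> and against \<open>M\<close> both equal the integral
  of \<open>f (cadj x)\<close> against \<open>M\<close>. With an explicit \<open>M\<close> at hand
  this settles existence and uniqueness in the definite description.\<close>

lemma haar_eqI: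
  fixes M :: "(complex^'n^'n) measure"
  assumes G: "\<And>g. g \<in> G \<Longrightarrow> cadj g \<in> G" and M: "is_haar G M"
  shows "haar G = M"
  unfolding haar_def
proof (rule the_equality)
  show "is_haar G M" by (rule M)
next
  fix N assume N: "is_haar G N"
  have sets: "sets N = sets borel" "sets M = sets borel" using M N by (auto simp: is_haar_def)
  show "N = M"
  proof (rule measure_eqI)
    fix A assume A: "A \<in> sets N"
    then have "indicator A \<in> borel_measurable (borel :: (complex^'n^'n) measure)"
      by (simp add: sets)
    from is_haar_integral_cadj[OF G N M this] is_haar_integral_cadj[OF G M M this]
    show "emeasure N A = emeasure M A" using A by (simp add: sets)
  qed (simp add: sets)
qed

section \<open>Small index types and SU(2) as the unit quaternions\<close>

lemma two_eq_0: "(2::2) = 0" and four_eq_0: "(4::4) = 0"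
  by simp_all

text \<open>The index types are residue rings, so 2 and 0 name the same index in type
  \<open>2\<close>. This converts enumerations starting at 1 to the numbering from 0 used for the
  matrices here.\<close>

lemma sum_UNIV_2: "sum f (UNIV :: 2 set) = f 0 + f 1"
  using sum_2[of f] unfolding two_eq_0 by (simp add: add.commute)

lemma sum_UNIV_4: "sum f (UNIV :: 4 set) = f 0 + f 1 + f 2 + f 3"
  using sum_4[of f] unfolding four_eq_0 by (simp add: add_ac)

lemma all_2: "(\<forall>i::2. P i) \<longleftrightarrow> P 0 \<and> P 1"
  using forall_2[of P] unfolding two_eq_0 by auto

lemma all_4: "(\<forall>i::4. P i) \<longleftrightarrow> P 0 \<and> P 1 \<and> P 2 \<and> P 3"
  using forall_4[of P] unfolding four_eq_0 by auto

lemma det_UNIV_2: "det (A :: complex^2^2) = A$0$0 * A$1$1 - A$0$1 * A$1$0"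
  using det_2[of A] unfolding two_eq_0 by (simp add: algebra_simps)

lemma trace_UNIV_4: "trace (A :: complex^4^4) = A$0$0 + A$1$1 + A$2$2 + A$3$3"
  by (simp add: trace_def sum_UNIV_4)

lemma of_real_cmod_power2: "(complex_of_real (cmod z))\<^sup>2 = z * cnj z"
  by (metis complex_norm_square of_real_power)

lemma norm_vec_2: "(norm (x :: complex^2))\<^sup>2 = (cmod (x$0))\<^sup>2 + (cmod (x$1))\<^sup>2"
  by (simp add: norm_vec_def L2_set_def sum_UNIV_2)

lemma norm_vec_4: "(norm (x :: complex^4))\<^sup>2 = (cmod (x$0))\<^sup>2 + (cmod (x$1))\<^sup>2 + (cmod (x$2))\<^sup>2 + (cmod (x$3))\<^sup>2"
  by (simp add: norm_vec_def L2_set_def sum_UNIV_4)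

text \<open>Left multiplication by the quaternion with coordinates \<open>x\<close>, as a matrix
  whose first column is \<open>x\<close> itself. Such matrices form an algebra in which the first
  column determines the rest, so matrix products reduce to \<open>su2_mat x *v y\<close>.\<close>

definition su2_mat :: "complex^2 \<Rightarrow> complex^2^2" where
  "su2_mat x = (\<chi> i j. if j = 0 then x $ i else if i = 0 then - cnj (x$1) else cnj (x$0))"

lemma su2_mat_nth [simp]:
  "su2_mat x $ 0 $ 0 = x $ 0" "su2_mat x $ 1 $ 0 = x $ 1"
  "su2_mat x $ 0 $ 1 = - cnj (x $ 1)" "su2_mat x $ 1 $ 1 = cnj (x $ 0)"
  by (simp_all add: su2_mat_def)

lemma su2_mat_mult: "su2_mat x ** su2_mat y = su2_mat (su2_mat x *v y)"
  by (simp add: vec_eq_iff all_2 matrix_matrix_mult_def matrix_vector_mult_def sum_UNIV_2 algebra_simps)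

lemma cadj_nth [simp]: "cadj A $ i $ j = cnj (A $ j $ i)"
  by (simp add: cadj_def)

text \<open>Euler's four-square identity. The squared norms are moved to the complex numbers, where
  \<open>z * cnj z\<close> makes it polynomial.\<close>

lemma norm_su2_mat_mult: "norm (su2_mat x *v y) = norm x * norm y"
proof (rule power2_eq_imp_eq)
  have "complex_of_real ((norm (su2_mat x *v y))\<^sup>2) = complex_of_real ((norm x * norm y)\<^sup>2)"
    unfolding power_mult_distrib norm_vec_2 of_real_add of_real_mult of_real_power of_real_cmod_power2
    by (simp add: matrix_vector_mult_def sum_UNIV_2 algebra_simps)
  then show "(norm (su2_mat x *v y))\<^sup>2 = (norm x * norm y)\<^sup>2"
    by (simp only: of_real_eq_iff)
qed simp_all

lemma cadj_su2_mat: "cadj (su2_mat x) = su2_mat (\<chi> i. if i = 0 then cnj (x$0) else - x$1)"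
  by (simp add: vec_eq_iff all_2)

text \<open>For determinant 1 the inverse is the adjugate, for a unitary matrix it is the adjoint;
  comparing the two expresses the second column through the first.\<close>

lemma SU2_eq: "SU2 = su2_mat ` sphere 0 1"
proof safe
  fix U assume "U \<in> SU2"
  then have UU: "U ** cadj U = mat 1" and det: "det U = 1"
    by (auto simp: SU2_def unitary_mats_def)
  have u: "(U ** cadj U) $ i $ j = (mat 1 :: complex^2^2) $ i $ j" for i j by (simp add: UU)
  let ?a = "U$0$0" and ?b = "U$0$1" and ?c = "U$1$0" and ?d = "U$1$1"
  have eqs: "?a * cnj ?a + ?b * cnj ?b = 1" "?a * cnj ?c + ?b * cnj ?d = 0"
    "?c * cnj ?a + ?d * cnj ?b = 0" "?c * cnj ?c + ?d * cnj ?d = 1"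
    using u[of 0 0] u[of 0 1] u[of 1 0] u[of 1 1]
    by (simp_all add: matrix_matrix_mult_def sum_UNIV_2 mat_def)
  have dt: "?a * ?d - ?b * ?c = 1" using det by (simp add: det_UNIV_2)
  have d: "cnj ?d = ?a" using eqs dt by algebra
  have b: "cnj ?b = - ?c" using eqs dt by algebra
  have d': "?d = cnj ?a" using d by (metis complex_cnj_cnj)
  have b': "?b = - cnj ?c" using b by (metis complex_cnj_cnj complex_cnj_minus)
  let ?x = "\<chi> i. U $ i $ 0"
  have U: "U = su2_mat ?x" by (simp add: vec_eq_iff all_2 b' d')
  have "complex_of_real ((norm ?x)\<^sup>2) = 1"
    using eqs(1) unfolding b' by (simp add: norm_vec_2 of_real_cmod_power2 mult.commute)
  then have "(norm ?x)\<^sup>2 = 1" by (metis of_real_eq_1_iff)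
  then have "norm ?x = 1" by (metis abs_norm_cancel real_sqrt_abs real_sqrt_one)
  then show "U \<in> su2_mat ` sphere 0 1" using U by auto
next
  fix x :: "complex^2" assume "x \<in> sphere 0 1"
  then have "(norm x)\<^sup>2 = 1" by simp
  then have "complex_of_real ((norm x)\<^sup>2) = 1" by simp
  then have *: "x$0 * cnj (x$0) + x$1 * cnj (x$1) = 1"
    by (simp add: norm_vec_2 of_real_cmod_power2 mult.commute)
  then show "su2_mat x \<in> SU2"
    by (auto simp: SU2_def unitary_mats_def vec_eq_iff all_2 matrix_matrix_mult_def sum_UNIV_2 mat_def det_UNIV_2 algebra_simps)
qed

lemma blockdiag_mult: "blockdiag A B ** blockdiag C D = blockdiag (A ** C) (B ** D)"
  by (simp add: vec_eq_iff all_4 matrix_matrix_mult_def sum_UNIV_4 sum_UNIV_2 blockdiag_def blk1_def idx2_def)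

lemma cadj_blockdiag: "cadj (blockdiag A B) = blockdiag (cadj A) (cadj B)"
  by (simp add: vec_eq_iff all_4 blockdiag_def blk1_def idx2_def)

lemma continuous_on_su2_mat [continuous_intros]:
  "continuous_on S f \<Longrightarrow> continuous_on S (\<lambda>x. su2_mat (f x))"
  unfolding su2_mat_def
  apply (intro continuous_on_vec_lambda)
  subgoal for i j
    by (cases "j = 0"; cases "i = 0") (auto intro!: continuous_intros)
  done

lemma continuous_on_blockdiag [continuous_intros]:
  "continuous_on S f \<Longrightarrow> continuous_on S g \<Longrightarrow> continuous_on S (\<lambda>x. blockdiag (f x) (g x))"
  unfolding blockdiag_def
  apply (intro continuous_on_vec_lambda)
  subgoal for i j
    by (cases "blk1 i"; cases "blk1 j") (auto intro!: continuous_intros)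
  done

subsection \<open>Structure of the symplectic group\<close>

lemma linear_matrix_vector_mul_complex: "linear (\<lambda>x. (A :: complex^'n^'m) *v x)"
  by (rule linearI) (simp_all add: vec_eq_iff matrix_vector_mult_def
      scaleR_sum_right sum.distrib distrib_left)

lemma unitary_mats_cadj_mult: "U \<in> unitary_mats \<Longrightarrow> cadj U ** U = mat 1"
  unfolding unitary_mats_def by (simp add: matrix_left_right_inverse)

lemma surj_unitary_mult: "U \<in> unitary_mats \<Longrightarrow> surj (\<lambda>x. U *v x)"
  by (rule surjI[where f = "\<lambda>x. cadj U *v x"]) (simp add: matrix_vector_mul_assoc unitary_mats_def)

text \<open>
  Identifying \<open>complex^4\<close> with pairs of quaternions, \<open>quat_mult_j x\<close> is the vector \<open>- J4 *v cnj x\<close>; it commutes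
  with \<open>USp4\<close>, so columns 1 and 3 of an element of \<open>USp4\<close> are determined by columns 0 and 2.
\<close>
definition quat_mult_j :: "complex^4 \<Rightarrow> complex^4" where
  "quat_mult_j x = (\<chi> i. if i = 0 then - cnj (x$1) else if i = 1 then cnj (x$0)
     else if i = 2 then - cnj (x$3) else cnj (x$2))"

lemma quat_mult_j_nth [simp]:
  "quat_mult_j x $ 0 = - cnj (x$1)" "quat_mult_j x $ 1 = cnj (x$0)"
  "quat_mult_j x $ 2 = - cnj (x$3)" "quat_mult_j x $ 3 = cnj (x$2)"
  by (simp_all add: quat_mult_j_def)

definition usp4_mat :: "complex^4 \<Rightarrow> complex^4 \<Rightarrow> complex^4^4" where
  "usp4_mat x y = (\<chi> i j. if j = 0 then x$i else if j = 1 then quat_mult_j x $ i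
     else if j = 2 then y$i else quat_mult_j y $ i)"

lemma usp4_mat_nth [simp]:
  "usp4_mat x y $ i $ 0 = x$i" "usp4_mat x y $ i $ 1 = quat_mult_j x $ i"
  "usp4_mat x y $ i $ 2 = y$i" "usp4_mat x y $ i $ 3 = quat_mult_j y $ i"
  by (simp_all add: usp4_mat_def)

lemma usp4_mat_mult:
  "usp4_mat a b ** usp4_mat x y = usp4_mat (usp4_mat a b *v x) (usp4_mat a b *v y)"
  by (simp add: vec_eq_iff all_4 matrix_matrix_mult_def matrix_vector_mult_def sum_UNIV_4)

lemma USp4_subset_unitary: "U \<in> USp4 \<Longrightarrow> U \<in> unitary_mats"
  by (simp add: USp4_def)

text \<open>Cancelling \<open>transpose U\<close> by its inverse \<open>transpose (cadj U)\<close>,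
  the entrywise conjugate of \<open>U\<close>, turns the quadratic symplectic condition into a
  real-linear one that can be read off column by column. It expresses quaternionic linearity of
  \<open>U\<close>.\<close>

lemma USp4_J4_commute:
  assumes "U \<in> USp4"
  shows "J4 ** U = transpose (cadj U) ** J4"
proof -
  have U: "U ** cadj U = mat 1" "transpose U ** J4 ** U = J4"
    using assms by (auto simp: USp4_def unitary_mats_def)
  have "transpose (cadj U) ** transpose U = mat 1"
    unfolding matrix_transpose_mul[symmetric] U(1) by (rule transpose_mat)
  then have "J4 ** U = transpose (cadj U) ** (transpose U ** J4 ** U)"
    by (simp add: matrix_mul_assoc)
  then show ?thesis unfolding U(2) .
qed

lemma USp4_cadj:
  assumes "U \<in> USp4"
  shows "cadj U \<in> USp4"
proof -
  have "U ** cadj U = mat 1" using assms by (auto simp: USp4_def unitary_mats_def)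
  then have "transpose (cadj U) ** J4 ** cadj U = J4"
    unfolding USp4_J4_commute[OF assms, symmetric] by (simp add: matrix_mul_assoc[symmetric])
  then show ?thesis
    using unitary_mats_cadj_mult[OF USp4_subset_unitary[OF assms]]
    by (simp add: USp4_def unitary_mats_def)
qed

lemma USp4_mult:
  assumes "U \<in> USp4" "V \<in> USp4"
  shows "U ** V \<in> USp4"
proof -
  have U: "U ** cadj U = mat 1" "transpose U ** J4 ** U = J4"
    and V: "V ** cadj V = mat 1" "transpose V ** J4 ** V = J4"
    using assms by (auto simp: USp4_def unitary_mats_def)
  have "(U ** V) ** cadj (U ** V) = U ** (V ** cadj V) ** cadj U"
    by (simp add: cadj_mult matrix_mul_assoc)
  moreover have "transpose (U ** V) ** J4 ** (U ** V) = transpose V ** (transpose U ** J4 ** U) ** V"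
    by (simp add: matrix_transpose_mul matrix_mul_assoc)
  ultimately show ?thesis by (simp add: USp4_def unitary_mats_def U V)
qed

lemma USp4_eq_usp4_mat:
  assumes "U \<in> USp4"
  shows "U = usp4_mat (column 0 U) (column 2 U)"
proof -
  have "(J4 ** U) $ i $ j = (transpose (cadj U) ** J4) $ i $ j" for i j
    by (simp add: USp4_J4_commute[OF assms])
  \<comment> \<open>\<open>J4\<close> maps the basis vectors 1 and 3 to 0 and 2, so columns 1 and 3
    of the commutation relation express these columns of \<open>U\<close> through conjugates of
    columns 0 and 2.\<close>
  from this[of 0 1] this[of 1 1] this[of 2 1] this[of 3 1] this[of 0 3] this[of 1 3] this[of 2 3] this[of 3 3]
  show ?thesis
    by (simp add: vec_eq_iff all_4 matrix_matrix_mult_def sum_UNIV_4 transpose_def J4_def column_def minus_equation_iff[of _ "cnj _"]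
        equation_minus_iff)
qed

lemma USp4_mult_usp4_mat:
  "U \<in> USp4 \<Longrightarrow> U ** usp4_mat x y = usp4_mat (U *v x) (U *v y)"
  using USp4_eq_usp4_mat[of U] usp4_mat_mult[of "column 0 U" "column 2 U" x y] by simp

text \<open>\<open>orth\<close> and \<open>symp\<close> say that \<open>y\<close> is orthogonal to
  \<open>x\<close> and to \<open>quat_mult_j x\<close>, that is, to the quaternionic line of
  \<open>x\<close>. Together with their conjugates and the two norm equations they imply every
  matrix entry by polynomial algebra.\<close>

lemma usp4_mat_in_USp4:
  assumes x: "norm x = 1" and y: "norm y = 1"
    and orth: "cnj (x$0) * y$0 + cnj (x$1) * y$1 + cnj (x$2) * y$2 + cnj (x$3) * y$3 = 0"
    and symp: "x$0 * y$1 - x$1 * y$0 + x$2 * y$3 - x$3 * y$2 = 0"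
  shows "usp4_mat x y \<in> USp4"
proof -
  have "complex_of_real ((norm x)\<^sup>2) = 1" "complex_of_real ((norm y)\<^sup>2) = 1"
    by (simp_all add: x y)
  then have n: "x$0 * cnj (x$0) + x$1 * cnj (x$1) + x$2 * cnj (x$2) + x$3 * cnj (x$3) = 1"
     "y$0 * cnj (y$0) + y$1 * cnj (y$1) + y$2 * cnj (y$2) + y$3 * cnj (y$3) = 1"
    by (simp_all only: norm_vec_4 of_real_add of_real_power of_real_cmod_power2)
  have orth': "x$0 * cnj (y$0) + x$1 * cnj (y$1) + x$2 * cnj (y$2) + x$3 * cnj (y$3) = 0"
    using arg_cong[OF orth, of cnj] by simp
  have symp': "cnj (x$0) * cnj (y$1) - cnj (x$1) * cnj (y$0) + cnj (x$2) * cnj (y$3) - cnj (x$3) * cnj (y$2) = 0"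
    using arg_cong[OF symp, of cnj] by simp
  note eqs = n orth orth' symp symp'
  let ?U = "usp4_mat x y"
  have "cadj ?U ** ?U = mat 1"
    unfolding vec_eq_iff all_4
    apply (simp add: matrix_matrix_mult_def sum_UNIV_4 mat_def)
    apply (intro conjI; use eqs in algebra)
    done
  then have "?U ** cadj ?U = mat 1" by (simp add: matrix_left_right_inverse)
  moreover have "transpose ?U ** J4 ** ?U = J4"
    unfolding vec_eq_iff all_4
    apply (simp add: matrix_matrix_mult_def sum_UNIV_4 transpose_def J4_def)
    apply (intro conjI; use eqs in algebra)
    done
  ultimately show ?thesis by (simp add: USp4_def unitary_mats_def)
qed

lemma norm_USp4_mult:
  assumes "U \<in> USp4"
  shows "norm (U *v x) = norm x"
proof (rule power2_eq_imp_eq)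
  \<comment> \<open>\<open>usp4_mat z z\<close> serves only as a matrix with first column
    \<open>z\<close>: the corner of its Gram matrix is the squared norm, and \<open>U\<close> acts
    on its columns.\<close>
  have sq: "complex_of_real ((norm z)\<^sup>2) = (cadj (usp4_mat z z) ** usp4_mat z z) $ 0 $ 0" for z
    unfolding norm_vec_4 of_real_add of_real_power of_real_cmod_power2
    by (simp add: matrix_matrix_mult_def sum_UNIV_4 mult.commute)
  have "cadj (usp4_mat (U *v x) (U *v x)) ** usp4_mat (U *v x) (U *v x) =
      cadj (usp4_mat x x) ** (cadj U ** U) ** usp4_mat x x"
    unfolding USp4_mult_usp4_mat[OF assms, symmetric] cadj_mult by (simp only: matrix_mul_assoc)
  also have "\<dots> = cadj (usp4_mat x x) ** usp4_mat x x"
    by (simp add: unitary_mats_cadj_mult[OF USp4_subset_unitary[OF assms]])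
  finally have "complex_of_real ((norm (U *v x))\<^sup>2) = complex_of_real ((norm x)\<^sup>2)"
    by (simp only: sq)
  then show "(norm (U *v x))\<^sup>2 = (norm x)\<^sup>2" by (simp only: of_real_eq_iff)
qed simp_all

section \<open>An explicit section of the first-column map\<close>

definition join4 :: "complex^2 \<Rightarrow> complex^2 \<Rightarrow> complex^4" where
  "join4 a c = (\<chi> i. if blk1 i then a $ idx2 i else c $ idx2 i)"

definition fst4 :: "complex^4 \<Rightarrow> complex^2" where
  "fst4 x = (\<chi> i. if i = 0 then x$0 else x$1)"

definition snd4 :: "complex^4 \<Rightarrow> complex^2" where
  "snd4 x = (\<chi> i. if i = 0 then x$2 else x$3)"

lemma join4_nth [simp]:
  "join4 a c $ 0 = a$0" "join4 a c $ 1 = a$1" "join4 a c $ 2 = c$0" "join4 a c $ 3 = c$1"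
  by (simp_all add: join4_def blk1_def idx2_def)

lemma fst4_nth [simp]: "fst4 x $ 0 = x$0" "fst4 x $ 1 = x$1"
  and snd4_nth [simp]: "snd4 x $ 0 = x$2" "snd4 x $ 1 = x$3"
  by (simp_all add: fst4_def snd4_def)

lemma join4_fst4_snd4 [simp]: "join4 (fst4 x) (snd4 x) = x"
  and fst4_join4 [simp]: "fst4 (join4 a c) = a" and snd4_join4 [simp]: "snd4 (join4 a c) = c"
  by (simp_all add: vec_eq_iff all_4 all_2)

lemma norm_join4: "(norm (join4 a c))\<^sup>2 = (norm a)\<^sup>2 + (norm c)\<^sup>2"
  by (simp add: norm_vec_2 norm_vec_4)

text \<open>The value \<open>axis 0 1\<close> at 0 keeps the result a unit vector everywhere, while
  \<open>norm a *\<^sub>R unit_dir a = a\<close> still holds there.\<close>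

definition unit_dir :: "complex^2 \<Rightarrow> complex^2" where
  "unit_dir a = (if a = 0 then axis 0 1 else sgn a)"

lemma norm_unit_dir [simp]: "norm (unit_dir a) = 1"
  by (simp add: unit_dir_def norm_sgn)

lemma norm_scaleR_unit_dir: "norm a *\<^sub>R unit_dir a = a"
  by (simp add: unit_dir_def sgn_div_norm)

text \<open>
  With \<open>x = (a, c)\<close>, \<open>a = norm a *\<^sub>R u\<close> and \<open>c = norm c *\<^sub>R w\<close>, this is \<open>(- norm c *\<^sub>R u, norm a *\<^sub>R w)\<close>: among the
  unit vectors orthogonal to the quaternionic line of \<open>x\<close>, the choice whose second half has the norm of \<open>a\<close>
  and a direction depending on \<open>c\<close> only.
\<close>
definition perp4 :: "complex^4 \<Rightarrow> complex^4" where
  "perp4 x = join4 (- norm (snd4 x) *\<^sub>R unit_dir (fst4 x)) (norm (fst4 x) *\<^sub>R unit_dir (snd4 x))"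

definition frame4 :: "complex^4 \<Rightarrow> complex^4^4" where
  "frame4 x = usp4_mat x (perp4 x)"

text \<open>In the notation \<open>r\<close>, \<open>s\<close>, \<open>u\<close>, \<open>w\<close>,
  orthogonality amounts to \<open>s * r - r * s = 0\<close>, because \<open>u\<close> and
  \<open>w\<close> are unit vectors. The symplectic pairing vanishes within each block, since both
  vectors there are real multiples of the same direction.\<close>

lemma frame4_in_USp4:
  assumes "norm x = 1"
  shows "frame4 x \<in> USp4"
  unfolding frame4_def
proof (rule usp4_mat_in_USp4)
  define r s u w where "r = norm (fst4 x)" and "s = norm (snd4 x)"
    and "u = unit_dir (fst4 x)" and "w = unit_dir (snd4 x)"
  have a: "fst4 x = r *\<^sub>R u" and c: "snd4 x = s *\<^sub>R w"
    by (simp_all add: r_def s_def u_def w_def norm_scaleR_unit_dir)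
  have x: "x$0 = r * u$0" "x$1 = r * u$1" "x$2 = s * w$0" "x$3 = s * w$1"
    using arg_cong[OF a, of "\<lambda>z. z$0"] arg_cong[OF a, of "\<lambda>z. z$1"]
      arg_cong[OF c, of "\<lambda>z. z$0"] arg_cong[OF c, of "\<lambda>z. z$1"]
    unfolding vector_scaleR_component by (simp_all add: scaleR_conv_of_real)
  have y: "perp4 x $ 0 = - s * u$0" "perp4 x $ 1 = - s * u$1" "perp4 x $ 2 = r * w$0" "perp4 x $ 3 = r * w$1"
    unfolding perp4_def join4_nth vector_scaleR_component
    by (simp_all add: r_def s_def u_def w_def scaleR_conv_of_real)
  have "complex_of_real ((norm u)\<^sup>2) = 1" "complex_of_real ((norm w)\<^sup>2) = 1"
    by (simp_all add: u_def w_def)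
  then have n: "u$0 * cnj (u$0) + u$1 * cnj (u$1) = 1" "w$0 * cnj (w$0) + w$1 * cnj (w$1) = 1"
    by (simp_all only: norm_vec_2 of_real_add of_real_power of_real_cmod_power2)
  show "norm x = 1" by fact
  have "(norm (perp4 x))\<^sup>2 = (norm (join4 (fst4 x) (snd4 x)))\<^sup>2"
    unfolding perp4_def norm_join4 by simp
  then show "norm (perp4 x) = 1"
    using assms by (metis abs_norm_cancel join4_fst4_snd4 real_sqrt_abs)
  show "cnj (x$0) * perp4 x$0 + cnj (x$1) * perp4 x$1 + cnj (x$2) * perp4 x$2 + cnj (x$3) * perp4 x$3 = 0"
    unfolding x y using n by simp algebra
  show "x$0 * perp4 x$1 - x$1 * perp4 x$0 + x$2 * perp4 x$3 - x$3 * perp4 x$2 = 0"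
    unfolding x y by algebra
qed

text \<open>This is a fibre of the first-column map. The given column 0 fixes column 1 through
  \<open>quat_mult_j\<close>, unitarity then clears the upper half of column 2, and what is left is
  a unit quaternion.\<close>

lemma USp4_stabilizer:
  assumes U: "U \<in> USp4" and col: "\<And>i. U $ i $ 0 = mat 1 $ i $ 0"
  obtains p where "norm p = 1" "U = blockdiag (mat 1) (su2_mat p)"
proof -
  define x y where "x = column 0 U" and "y = column 2 U"
  have U': "U = usp4_mat x y"
    using USp4_eq_usp4_mat[OF U] by (simp add: x_def y_def)
  have x: "x $ 0 = 1" "x $ 1 = 0" "x $ 2 = 0" "x $ 3 = 0"
    using col by (simp_all add: x_def column_def mat_def)
  have UU: "(cadj U ** U) $ i $ j = (mat 1 :: complex^4^4) $ i $ j" for i j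
    by (simp add: unitary_mats_cadj_mult[OF USp4_subset_unitary[OF U]])
  have y: "y $ 0 = 0" "y $ 1 = 0"
    using UU[of 0 2] UU[of 1 2] x unfolding U'
    by (simp_all add: matrix_matrix_mult_def sum_UNIV_4 mat_def)
  have "cnj (y$2) * y$2 + cnj (y$3) * y$3 = 1"
    using UU[of 2 2] x y unfolding U'
    by (simp add: matrix_matrix_mult_def sum_UNIV_4 mat_def)
  then have "complex_of_real ((norm (snd4 y))\<^sup>2) = 1"
    unfolding norm_vec_2 of_real_add of_real_power of_real_cmod_power2 by (simp add: mult.commute)
  then have "(norm (snd4 y))\<^sup>2 = 1" by (simp only: of_real_eq_1_iff)
  then have "norm (snd4 y) = 1" by (metis abs_norm_cancel real_sqrt_abs real_sqrt_one)
  moreover have "U = blockdiag (mat 1) (su2_mat (snd4 y))"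
    by (subst U') (simp add: vec_eq_iff all_4 blockdiag_def blk1_def idx2_def x y mat_def)
  ultimately show ?thesis by (rule that)
qed

text \<open>Both \<open>g ** frame4 x\<close> and \<open>frame4 (g *v x)\<close> have first column
  \<open>g *v x\<close>, so they differ by a right factor fixing the first basis vector. This factor
  may depend on \<open>x\<close> as well as on \<open>g\<close>.\<close>

lemma USp4_mult_frame4:
  assumes g: "g \<in> USp4" and x: "norm x = 1"
  obtains p where "norm p = 1" "g ** frame4 x = frame4 (g *v x) ** blockdiag (mat 1) (su2_mat p)"
proof -
  let ?F = "frame4 (g *v x)"
  have F: "?F \<in> USp4" by (rule frame4_in_USp4) (simp add: norm_USp4_mult g x)
  have gF: "g ** frame4 x = usp4_mat (g *v x) (g *v perp4 x)"
    unfolding frame4_def by (rule USp4_mult_usp4_mat[OF g])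
  let ?W = "cadj ?F ** (g ** frame4 x)"
  have W: "?W \<in> USp4" by (intro USp4_mult USp4_cadj F g frame4_in_USp4 x)
  have "?W $ i $ 0 = (cadj ?F ** ?F) $ i $ 0" for i
    unfolding gF by (simp add: matrix_matrix_mult_def frame4_def)
  then have "?W $ i $ 0 = mat 1 $ i $ 0" for i
    by (simp add: unitary_mats_cadj_mult[OF USp4_subset_unitary[OF F]])
  then obtain p where p: "norm p = 1" "?W = blockdiag (mat 1) (su2_mat p)"
    using USp4_stabilizer[OF W] by blast
  have "g ** frame4 x = (?F ** cadj ?F) ** (g ** frame4 x)"
    using F by (simp add: USp4_def unitary_mats_def)
  also have "\<dots> = ?F ** ?W" by (simp add: matrix_mul_assoc)
  finally show ?thesis using p that by simp
qed

lemma su2_block_in_USp4: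
  assumes "norm p = 1"
  shows "blockdiag (mat 1) (su2_mat p) \<in> USp4"
proof -
  have "blockdiag (mat 1) (su2_mat p) = usp4_mat (axis 0 1) (join4 0 p)"
    by (simp add: vec_eq_iff all_4 blockdiag_def blk1_def idx2_def mat_def axis_def)
  also have "\<dots> \<in> USp4"
  proof (rule usp4_mat_in_USp4)
    have "(norm (join4 0 p))\<^sup>2 = 1" using assms by (simp add: norm_join4)
    then show "norm (join4 0 p) = 1" by (metis abs_norm_cancel real_sqrt_abs real_sqrt_one)
    show "norm (axis 0 1 :: complex^4) = 1" by simp
  qed (simp_all add: axis_def)
  finally show ?thesis .
qed

text \<open>Here the choice of \<open>perp4\<close> pays off: the lower diagonal block is
  \<open>norm (fst4 x)\<close> times a product of unit quaternions, so the same length governs both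
  terms, and the dependence on \<open>snd4 x\<close> sits in a unit quaternion multiplying
  \<open>p\<close>.\<close>

lemma Re_trace_frame4:
  "Re (trace (frame4 x ** blockdiag (mat 1) (su2_mat p))) =
     2 * Re (x$0) + 2 * norm (fst4 x) * Re ((su2_mat (unit_dir (snd4 x)) *v p) $ 0)"
  by (simp add: trace_UNIV_4 matrix_matrix_mult_def matrix_vector_mult_def sum_UNIV_4 sum_UNIV_2 frame4_def
      perp4_def blockdiag_def blk1_def idx2_def mat_def algebra_simps)

subsection \<open>Explicit Haar measures\<close>

text \<open>Invariance is asked for iterated integrals so that \<open>p\<close> can be moved by an
  amount depending on the fixed \<open>x\<close>. Membership in \<open>G\<close> is asked at unit
  vectors, which carry the whole mass of \<open>sphere_measure\<close>.\<close>

lemma is_haar_distr_pairI: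
  fixes F :: "'a::euclidean_space \<times> 'b::euclidean_space \<Rightarrow> complex^'n^'n"
  assumes F[measurable]: "F \<in> borel_measurable (borel \<Otimes>\<^sub>M borel)" and G: "G \<in> sets borel"
    and mem: "\<And>x p. norm x = 1 \<Longrightarrow> norm p = 1 \<Longrightarrow> F (x, p) \<in> G"
    and inv: "\<And>g f. g \<in> G \<Longrightarrow> f \<in> borel_measurable borel \<Longrightarrow>
      (\<integral>\<^sup>+x. \<integral>\<^sup>+p. f (g ** F (x, p)) \<partial>sphere_measure \<partial>sphere_measure) =
      (\<integral>\<^sup>+x. \<integral>\<^sup>+p. (f (F (x, p)) :: ennreal) \<partial>sphere_measure \<partial>sphere_measure)"
  shows "is_haar G (distr (sphere_measure \<Otimes>\<^sub>M sphere_measure) borel F)"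
    (is "is_haar G ?M")
proof -
  interpret P: pair_prob_space "sphere_measure :: 'a measure" "sphere_measure :: 'b measure" ..
  have F': "F \<in> measurable (sphere_measure \<Otimes>\<^sub>M sphere_measure) borel" by measurable
  interpret M: prob_space ?M by (rule P.prob_space_distr[OF F'])
  have int: "(\<integral>\<^sup>+U. f U \<partial>?M) = (\<integral>\<^sup>+x. \<integral>\<^sup>+p. f (F (x, p)) \<partial>sphere_measure \<partial>sphere_measure)"
    if [measurable]: "f \<in> borel_measurable borel" for f :: "_ \<Rightarrow> ennreal"
    by (subst nn_integral_distr[OF F'], simp, subst sphere.nn_integral_fst[symmetric]) auto
  have "AE z in sphere_measure \<Otimes>\<^sub>M sphere_measure. F z \<in> G"
  proof (rule P.AE_pair_measure)
    show "{x \<in> space (sphere_measure \<Otimes>\<^sub>M sphere_measure). F x \<in> G} \<in> sets (sphere_measure \<Otimes>\<^sub>M sphere_measure)"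
      using G by measurable
    show "AE x in sphere_measure. AE y in sphere_measure. F (x, y) \<in> G"
      using AE_norm_sphere_measure[where 'a='a]
    proof eventually_elim
      fix x :: 'a assume "norm x = 1"
      show "AE y in sphere_measure. F (x, y) \<in> G"
        using AE_norm_sphere_measure[where 'a='b] by eventually_elim (rule mem[OF \<open>norm x = 1\<close>])
    qed
  qed
  then have "AE U in ?M. U \<in> G"
    using G by (subst AE_distr_iff[OF F']) auto
  then have "emeasure ?M G = 1"
    using G by (intro M.emeasure_eq_1_AE) auto
  moreover have "distr ?M borel (\<lambda>U. g ** U) = ?M" if g: "g \<in> G" for g
  proof (rule measure_eqI)
    fix A assume "A \<in> sets (distr ?M borel (\<lambda>U. g ** U))"
    then have [measurable]: "A \<in> sets borel" by simp
    have "emeasure (distr ?M borel (\<lambda>U. g ** U)) A = (\<integral>\<^sup>+U. indicator A U \<partial>distr ?M borel (\<lambda>U. g ** U))"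
      by simp
    also have "\<dots> = (\<integral>\<^sup>+U. indicator A (g ** U) \<partial>?M)"
      by (rule nn_integral_distr) measurable
    also have "\<dots> = (\<integral>\<^sup>+U. indicator A U \<partial>?M)"
      using inv[OF g, of "indicator A"] by (simp add: int del: nn_integral_indicator)
    finally show "emeasure (distr ?M borel (\<lambda>U. g ** U)) A = emeasure ?M A" by simp
  qed simp
  ultimately show ?thesis
    unfolding is_haar_def using M.prob_space_axioms by simp
qed

lemma measurable_su2_mat [measurable]: "su2_mat \<in> borel_measurable borel"
  by (intro borel_measurable_continuous_onI continuous_intros)

lemma measurable_blockdiag [measurable (raw)]:
  assumes [measurable]: "f \<in> borel_measurable M" "g \<in> borel_measurable M"
  shows "(\<lambda>x. blockdiag (f x) (g x)) \<in> borel_measurable M"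
proof -
  have "(\<lambda>p. blockdiag (fst p) (snd p)) \<in> borel_measurable borel"
    by (intro borel_measurable_continuous_onI continuous_intros)
  then have "(\<lambda>p. blockdiag (fst p) (snd p)) \<in> borel_measurable (borel \<Otimes>\<^sub>M borel)"
    by (simp add: borel_prod)
  from measurable_compose[OF _ this, of "\<lambda>x. (f x, g x)" M] show ?thesis by simp
qed

lemma measurable_vec_nth [measurable]: "(\<lambda>x. (x :: complex^'n) $ i) \<in> borel_measurable borel"
  by (intro borel_measurable_continuous_onI continuous_intros)

lemma nn_integral_sphere_su2_mult:
  assumes "norm w = 1" and "f \<in> borel_measurable borel"
  shows "(\<integral>\<^sup>+p. f (su2_mat w *v p) \<partial>sphere_measure) = (\<integral>\<^sup>+p. f p \<partial>sphere_measure)"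
proof (intro nn_integral_sphere_measure_isometry linear_matrix_vector_mul_complex surj_unitary_mult assms)
  show "su2_mat w \<in> unitary_mats"
    using SU2_eq assms(1) by (auto simp: SU2_def)
qed (simp add: norm_su2_mat_mult assms)

section \<open>Haar measure on the block-diagonal subgroup\<close>

lemma H4_eq: "H4 = (\<lambda>z. blockdiag (su2_mat (fst z)) (su2_mat (snd z))) ` (sphere 0 1 \<times> sphere 0 1)"
  unfolding H4_def SU2_eq by (auto simp: image_iff Bex_def split_paired_Ex; blast)

lemma H4I: "norm x = 1 \<Longrightarrow> norm p = 1 \<Longrightarrow> blockdiag (su2_mat x) (su2_mat p) \<in> H4"
  unfolding H4_eq by (rule image_eqI[where x = "(x, p)"]) auto

lemma H4_borel: "H4 \<in> sets borel"
  unfolding H4_eq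
  by (intro borel_closed compact_imp_closed compact_continuous_image compact_Times continuous_intros) auto

lemma H4_cadj:
  assumes "g \<in> H4"
  shows "cadj g \<in> H4"
proof -
  \<comment> \<open>\<open>c\<close> is quaternion conjugation, so
    \<open>cadj (su2_mat p) = su2_mat (c p)\<close>.\<close>
  define c where "c p = (\<chi> i::2. if i = 0 then cnj (p$0) else - p$1)" for p :: "complex^2"
  have c: "norm (c p) = 1" if "norm p = 1" for p
  proof -
    have "(norm (c p))\<^sup>2 = (norm p)\<^sup>2"
      by (simp add: norm_vec_2 c_def)
    then show ?thesis using that by (metis abs_norm_cancel real_sqrt_abs)
  qed
  obtain u w where "g = blockdiag (su2_mat u) (su2_mat w)" "norm u = 1" "norm w = 1"
    using assms unfolding H4_eq by auto
  then show ?thesis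
    by (simp add: cadj_blockdiag cadj_su2_mat c_def[symmetric] H4I c)
qed

lemma is_haar_H4:
  "is_haar H4 (distr (sphere_measure \<Otimes>\<^sub>M sphere_measure) borel (\<lambda>z. blockdiag (su2_mat (fst z)) (su2_mat (snd z))))"
proof (rule is_haar_distr_pairI)
  fix g :: "complex^4^4" and f :: "complex^4^4 \<Rightarrow> ennreal" assume "g \<in> H4" and [measurable]: "f \<in> borel_measurable borel"
  then obtain u w where g: "g = blockdiag (su2_mat u) (su2_mat w)" and u: "norm u = 1" and w: "norm w = 1"
    unfolding H4_eq by auto
  have "(\<integral>\<^sup>+x. \<integral>\<^sup>+p. f (g ** blockdiag (su2_mat (fst (x, p))) (su2_mat (snd (x, p)))) \<partial>sphere_measure \<partial>sphere_measure)
    = (\<integral>\<^sup>+x. \<integral>\<^sup>+p. f (blockdiag (su2_mat (su2_mat u *v x)) (su2_mat p)) \<partial>sphere_measure \<partial>sphere_measure)"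
    by (simp add: g blockdiag_mult su2_mat_mult
        nn_integral_sphere_su2_mult[OF w, of "\<lambda>q. f (blockdiag _ (su2_mat q))"])
  also have "\<dots> = (\<integral>\<^sup>+x. \<integral>\<^sup>+p. f (blockdiag (su2_mat x) (su2_mat p)) \<partial>sphere_measure \<partial>sphere_measure)"
    by (rule nn_integral_sphere_su2_mult[OF u, of "\<lambda>x. \<integral>\<^sup>+p. f (blockdiag (su2_mat x) (su2_mat p)) \<partial>sphere_measure"]) measurable
  finally show "(\<integral>\<^sup>+x. \<integral>\<^sup>+p. f (g ** blockdiag (su2_mat (fst (x, p))) (su2_mat (snd (x, p)))) \<partial>sphere_measure \<partial>sphere_measure)
    = (\<integral>\<^sup>+x. \<integral>\<^sup>+p. f (blockdiag (su2_mat (fst (x, p))) (su2_mat (snd (x, p)))) \<partial>sphere_measure \<partial>sphere_measure)"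
    by simp
qed (auto simp: H4_borel H4I)

section \<open>Haar measure on USp(4)\<close>

lemma USp4_borel: "USp4 \<in> sets borel"
proof -
  have "continuous_on UNIV (transpose :: complex^4^4 \<Rightarrow> _)"
    unfolding transpose_def by (intro continuous_intros)
  then show ?thesis
    unfolding USp4_def unitary_mats_def mem_Collect_eq
    by (intro borel_closed closed_Collect_conj closed_Collect_eq continuous_intros)
qed

text \<open>\<open>unit_dir\<close> jumps at 0, so \<open>frame4\<close> is assembled as a
  measurable map from this piece and continuous ones.\<close>

lemma measurable_frame4 [measurable]: "frame4 \<in> borel_measurable borel"
proof -
  have [measurable]: "unit_dir \<in> borel_measurable borel"
    unfolding unit_dir_def by measurable
  have lin: "continuous_on UNIV fst4" "continuous_on UNIV snd4"
    unfolding fst4_def snd4_def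
    by (intro continuous_on_vec_lambda; rename_tac i; case_tac "i = 0"; simp add: continuous_intros)+
  have [measurable]: "fst4 \<in> borel_measurable borel" "snd4 \<in> borel_measurable borel"
    using lin by (auto intro: borel_measurable_continuous_onI)
  have quat: "continuous_on UNIV quat_mult_j"
    unfolding quat_mult_j_def
    by (intro continuous_on_vec_lambda; rename_tac i; case_tac "i = 0"; case_tac "i = 1"; case_tac "i = 2";
        simp add: continuous_intros)
  have "continuous_on UNIV (\<lambda>(x, y). join4 x y)"
    unfolding join4_def case_prod_beta
    by (intro continuous_on_vec_lambda; rename_tac i; case_tac "blk1 i"; simp add: continuous_intros)
  then have [measurable]: "(\<lambda>(x, y). join4 x y) \<in> borel_measurable (borel \<Otimes>\<^sub>M borel)"
    unfolding borel_prod by (rule borel_measurable_continuous_onI)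
  have "continuous_on UNIV (\<lambda>(x, y). usp4_mat x y)"
    unfolding usp4_mat_def case_prod_beta
    by (intro continuous_on_vec_lambda; rename_tac i j; case_tac "j = 0"; case_tac "j = 1"; case_tac "j = 2";
        simp add: continuous_intros continuous_on_compose2[OF quat])
  then have [measurable]: "(\<lambda>(x, y). usp4_mat x y) \<in> borel_measurable (borel \<Otimes>\<^sub>M borel)"
    unfolding borel_prod by (rule borel_measurable_continuous_onI)
  have "(\<lambda>x. (\<lambda>(x, y). usp4_mat x y) (x, (\<lambda>(x, y). join4 x y) (- norm (snd4 x) *\<^sub>R unit_dir (fst4 x), norm (fst4 x) *\<^sub>R unit_dir (snd4 x))))
      \<in> borel_measurable borel" by measurable
  then show ?thesis unfolding frame4_def[abs_def] perp4_def by simp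
qed

lemma nn_integral_sphere_USp4_mult:
  assumes "g \<in> USp4" and "f \<in> borel_measurable borel"
  shows "(\<integral>\<^sup>+x. f (g *v x) \<partial>sphere_measure) = (\<integral>\<^sup>+x. f x \<partial>sphere_measure)"
  by (intro nn_integral_sphere_measure_isometry linear_matrix_vector_mul_complex surj_unitary_mult
      norm_USp4_mult USp4_subset_unitary assms)

text \<open>For fixed \<open>x\<close>, the inner integral over \<open>p\<close> absorbs the unit
  quaternion \<open>q\<close> by invariance on S^3; what remains depends on \<open>g *v x\<close>
  only, and \<open>g\<close> acts on S^7 as an isometry. The order matters because \<open>q\<close>
  depends on \<open>x\<close>.\<close>

lemma is_haar_USp4:
  "is_haar USp4 (distr (sphere_measure \<Otimes>\<^sub>M sphere_measure) borel
     (\<lambda>z. frame4 (fst z) ** blockdiag (mat 1) (su2_mat (snd z))))"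
proof (rule is_haar_distr_pairI)
  fix g :: "complex^4^4" and f :: "complex^4^4 \<Rightarrow> ennreal" assume g: "g \<in> USp4" and [measurable]: "f \<in> borel_measurable borel"
  let ?D = "\<lambda>p. blockdiag (mat 1) (su2_mat p)"
  have "(\<integral>\<^sup>+x. \<integral>\<^sup>+p. f (g ** (frame4 x ** ?D p)) \<partial>sphere_measure \<partial>sphere_measure)
    = (\<integral>\<^sup>+x. \<integral>\<^sup>+p. f (frame4 (g *v x) ** ?D p) \<partial>sphere_measure \<partial>sphere_measure)"
  proof (rule nn_integral_cong_AE, use AE_norm_sphere_measure in eventually_elim)
    fix x :: "complex^4" assume x: "norm x = 1"
    obtain q where q: "norm q = 1" "g ** frame4 x = frame4 (g *v x) ** ?D q"
      using USp4_mult_frame4[OF g x] .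
    have "g ** (frame4 x ** ?D p) = frame4 (g *v x) ** ?D (su2_mat q *v p)" for p
      by (simp add: matrix_mul_assoc q) (simp add: matrix_mul_assoc[symmetric] blockdiag_mult su2_mat_mult)
    then show "(\<integral>\<^sup>+p. f (g ** (frame4 x ** ?D p)) \<partial>sphere_measure) = (\<integral>\<^sup>+p. f (frame4 (g *v x) ** ?D p) \<partial>sphere_measure)"
      by (simp add: nn_integral_sphere_su2_mult[OF q(1), of "\<lambda>p. f (frame4 (g *v x) ** ?D p)"])
  qed
  also have "\<dots> = (\<integral>\<^sup>+x. \<integral>\<^sup>+p. f (frame4 x ** ?D p) \<partial>sphere_measure \<partial>sphere_measure)"
    by (rule nn_integral_sphere_USp4_mult[OF g, of "\<lambda>x. \<integral>\<^sup>+p. f (frame4 x ** ?D p) \<partial>sphere_measure"]) measurable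
  finally show "(\<integral>\<^sup>+x. \<integral>\<^sup>+p. f (g ** (frame4 (fst (x, p)) ** ?D (snd (x, p)))) \<partial>sphere_measure \<partial>sphere_measure)
    = (\<integral>\<^sup>+x. \<integral>\<^sup>+p. f (frame4 (fst (x, p)) ** ?D (snd (x, p))) \<partial>sphere_measure \<partial>sphere_measure)"
    by simp
qed (auto simp: USp4_borel intro!: USp4_mult frame4_in_USp4 su2_block_in_USp4)

lemma emeasure_mu_eps:
  fixes F :: "'a::euclidean_space \<times> 'b::euclidean_space \<Rightarrow> complex^'n^'n"
  assumes haar: "haar G = distr (sphere_measure \<Otimes>\<^sub>M sphere_measure) borel F"
    and [measurable]: "F \<in> borel_measurable (borel \<Otimes>\<^sub>M borel)" "A \<in> sets borel"
  shows "emeasure (mu_eps G) A =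
    (\<integral>\<^sup>+x. \<integral>\<^sup>+p. indicator A (Re (trace (F (x, p))) + 4) \<partial>sphere_measure \<partial>sphere_measure)"
proof -
  have [measurable]: "(\<lambda>U :: complex^'n^'n. Re (trace U) + 4) \<in> borel_measurable borel"
    unfolding trace_def by (intro borel_measurable_continuous_onI continuous_intros)
  have "emeasure (mu_eps G) A = (\<integral>\<^sup>+e. indicator A e \<partial>mu_eps G)"
    by (simp add: mu_eps_def)
  also have "\<dots> = (\<integral>\<^sup>+U. indicator A (Re (trace U) + 4) \<partial>haar G)"
    unfolding mu_eps_def by (subst nn_integral_distr) (simp_all add: haar)
  also have "\<dots> = (\<integral>\<^sup>+z. indicator A (Re (trace (F z)) + 4) \<partial>(sphere_measure \<Otimes>\<^sub>M sphere_measure))"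
    unfolding haar by (subst nn_integral_distr) auto
  also have "\<dots> = (\<integral>\<^sup>+x. \<integral>\<^sup>+p. indicator A (Re (trace (F (x, p))) + 4) \<partial>sphere_measure \<partial>sphere_measure)"
    by (subst sphere.nn_integral_fst[symmetric]) auto
  finally show ?thesis .
qed

subsection \<open>Distribution of the trace\<close>

text \<open>Sato-Tate law of the trace on SU(2), shifted by 2 so that its left edge is 0. Two such
  shifts add up to the 4 in \<open>mu_eps\<close>.\<close>

definition semicircle_density :: "real \<Rightarrow> real" where
  "semicircle_density y = (if 0 < y \<and> y < 4 then sqrt (y * (4 - y)) / (2 * pi) else 0)"

lemma measurable_semicircle_density [measurable]: "semicircle_density \<in> borel_measurable borel"
  unfolding semicircle_density_def[abs_def] by measurable

lemma semicircle_density_nonneg [simp]: "0 \<le> semicircle_density y"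
  by (simp add: semicircle_density_def)

text \<open>The unit sphere of the real line is the pair 1 and -1, to which reflection gives equal
  weight. The factor 2 avoids a division in \<open>ennreal\<close>.\<close>

lemma nn_integral_sphere_measure_real:
  assumes [measurable]: "h \<in> borel_measurable borel"
  shows "2 * (\<integral>\<^sup>+u. h u \<partial>(sphere_measure :: real measure)) = h 1 + h (- 1)"
proof -
  have "(\<integral>\<^sup>+u. h u \<partial>(sphere_measure :: real measure)) = (\<integral>\<^sup>+u. h (- u) \<partial>sphere_measure)"
    by (intro nn_integral_sphere_measure_isometry[symmetric] linear_uminus) (auto intro: surjI[of _ uminus])
  then have "2 * (\<integral>\<^sup>+u. h u \<partial>(sphere_measure :: real measure)) = (\<integral>\<^sup>+u. h u + h (- u) \<partial>sphere_measure)"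
    by (simp add: nn_integral_add mult_2)
  also have "\<dots> = (\<integral>\<^sup>+u. h 1 + h (- 1) \<partial>(sphere_measure :: real measure))"
    by (rule nn_integral_cong_AE, use AE_norm_sphere_measure in eventually_elim)
       (auto simp: abs_if add.commute split: if_splits)
  finally show ?thesis by (simp add: sphere.emeasure_space_1[simplified])
qed

text \<open>Reading \<open>complex^2\<close> as a line times a 3-space, the marginal formula with
  dimensions 1 and 3 gives \<open>\<bar>Re (x $ 0)\<bar>\<close> the density
  \<open>4 / pi * sqrt (1 - t\<^sup>2)\<close>, with an independent fair sign. The two signs produce
  the two halves of the semicircle.\<close>

lemma semicircle_law:
  assumes [measurable]: "f \<in> borel_measurable borel"
  shows "(\<integral>\<^sup>+x. f (2 + 2 * Re (x $ 0)) \<partial>(sphere_measure :: (complex^2) measure)) =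
    (\<integral>\<^sup>+y. ennreal (semicircle_density y) * f y \<partial>lborel)"
proof -
  define \<phi> :: "real \<times> (real \<times> complex) \<Rightarrow> complex^2"
    where "\<phi> z = (\<chi> i. if i = 0 then Complex (fst z) (fst (snd z)) else snd (snd z))" for z
  have \<phi>_nth: "\<phi> z $ 0 = Complex (fst z) (fst (snd z))" "\<phi> z $ 1 = snd (snd z)" for z
    by (simp_all add: \<phi>_def)
  have lin: "linear \<phi>"
    by (rule linearI) (simp_all add: vec_eq_iff all_2 \<phi>_nth complex_eq_iff)
  have iso: "distr sphere_measure borel \<phi> = sphere_measure"
  proof (rule distr_sphere_measure_isometry[OF lin])
    show "norm (\<phi> z) = norm z" for z
    proof (rule power2_eq_imp_eq)
      show "(norm (\<phi> z))\<^sup>2 = (norm z)\<^sup>2"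
        unfolding norm_vec_2 \<phi>_nth by (cases z) (simp add: norm_Pair cmod_power2)
    qed simp_all
    show "surj \<phi>"
      by (rule surjI[where f = "\<lambda>x. (Re (x$0), (Im (x$0), x$1))"]) (simp add: vec_eq_iff all_2 \<phi>_nth)
  qed
  have [measurable]: "\<phi> \<in> borel_measurable borel"
    using lin linear_continuous_on linear_conv_bounded_linear borel_measurable_continuous_onI by blast
  define C where "C = real DIM(real) * unit_ball_vol DIM(real) * (real DIM(real \<times> complex) * unit_ball_vol DIM(real \<times> complex)) /
      (real (DIM(real) + DIM(real \<times> complex)) * unit_ball_vol (DIM(real) + DIM(real \<times> complex)))"
  have C: "C = 4 / pi"
    unfolding C_def by (simp add: eval_unit_ball_vol field_simps power2_eq_square)
  define \<beta> where "\<beta> t = 4 / pi * sqrt (1 - t\<^sup>2)" for t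
  let ?H = "\<lambda>u. \<integral>\<^sup>+t. ennreal (\<beta> t) * indicator {0..<1} t * f (2 + 2 * (u * t)) \<partial>lborel"
  have [measurable]: "\<beta> \<in> borel_measurable borel" unfolding \<beta>_def by measurable
  \<comment> \<open>Substituting \<open>t = u * (y / 2 - 1)\<close> writes both signs as integrals
    over the same variable \<open>y = 2 + 2 * (u * t)\<close>.\<close>
  have half: "?H u = (\<integral>\<^sup>+y. ennreal (1 / 2 * \<beta> (y / 2 - 1)) * indicator {0..<1} (u * (y / 2 - 1)) * f y \<partial>lborel)"
    if u: "u = 1 \<or> u = - 1" for u
  proof -
    have "?H u = ennreal \<bar>u / 2\<bar> * (\<integral>\<^sup>+y. ennreal (\<beta> (- u + (u / 2) * y)) * indicator {0..<1} (- u + (u / 2) * y) *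
       f (2 + 2 * (u * (- u + (u / 2) * y))) \<partial>lborel)"
      using u by (intro nn_integral_real_affine) auto
    also have "\<dots> = (\<integral>\<^sup>+y. ennreal (1 / 2) * (ennreal (\<beta> (- u + (u / 2) * y)) * indicator {0..<1} (- u + (u / 2) * y) *
       f (2 + 2 * (u * (- u + (u / 2) * y)))) \<partial>lborel)"
      using u by (subst nn_integral_cmult) auto
    also have "\<dots> = (\<integral>\<^sup>+y. ennreal (1 / 2 * \<beta> (y / 2 - 1)) * indicator {0..<1} (u * (y / 2 - 1)) * f y \<partial>lborel)"
    proof (rule nn_integral_cong)
      fix y
      have "- u + (u / 2) * y = u * (y / 2 - 1)" "\<beta> (u * (y / 2 - 1)) = \<beta> (y / 2 - 1)"
        "2 + 2 * (u * (u * (y / 2 - 1))) = y"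
        using u by (auto simp: \<beta>_def algebra_simps power2_eq_square)
      then show "ennreal (1 / 2) * (ennreal (\<beta> (- u + (u / 2) * y)) * indicator {0..<1} (- u + (u / 2) * y) *
         f (2 + 2 * (u * (- u + (u / 2) * y)))) =
         ennreal (1 / 2 * \<beta> (y / 2 - 1)) * indicator {0..<1} (u * (y / 2 - 1)) * f y"
        by (simp only: ennreal_mult' mult.assoc)
    qed
    finally show ?thesis .
  qed
  have "2 * (\<integral>\<^sup>+x. f (2 + 2 * Re (x $ 0)) \<partial>(sphere_measure :: (complex^2) measure)) =
    2 * (\<integral>\<^sup>+x. f (2 + 2 * Re (x $ 0)) \<partial>distr (sphere_measure :: (real \<times> (real \<times> complex)) measure) borel \<phi>)"
    by (simp add: iso)
  also have "\<dots> = 2 * (\<integral>\<^sup>+z. f (2 + 2 * (sgn (fst z) * norm (fst z))) \<partial>(sphere_measure :: (real \<times> (real \<times> complex)) measure))"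
    by (subst nn_integral_distr) (auto simp: \<phi>_nth sgn_mult_abs)
  also have "\<dots> = 2 * (\<integral>\<^sup>+u. ?H u \<partial>sphere_measure)"
    using nn_integral_sphere_measure_fst[where 'a = real and 'b = "real \<times> complex" and F = "\<lambda>u t. f (2 + 2 * (u * t))"]
    unfolding C_def[symmetric] by (simp add: C \<beta>_def)
  also have "\<dots> = ?H 1 + ?H (- 1)"
    by (rule nn_integral_sphere_measure_real) measurable
  also have "\<dots> = (\<integral>\<^sup>+y. ennreal (1 / 2 * \<beta> (y / 2 - 1)) * indicator {0..<1} (1 * (y / 2 - 1)) * f y +
      ennreal (1 / 2 * \<beta> (y / 2 - 1)) * indicator {0..<1} ((- 1) * (y / 2 - 1)) * f y \<partial>lborel)"
    unfolding half[of 1, OF disjI1[OF refl]] half[of "- 1", OF disjI2[OF refl]]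
    by (rule nn_integral_add[symmetric]) measurable
  also have "\<dots> = (\<integral>\<^sup>+y. 2 * (ennreal (semicircle_density y) * f y) \<partial>lborel)"
  \<comment> \<open>At \<open>y = 2\<close> both indicators are 1, since each half includes
    \<open>t = 0\<close>; elsewhere in the support exactly one is.\<close>
  proof (rule nn_integral_cong_AE, use AE_lborel_singleton[of 2] in eventually_elim)
    fix y :: real assume "y \<noteq> 2"
    have "1 - (y / 2 - 1)\<^sup>2 = y * (4 - y) / 2\<^sup>2" by (simp add: power2_eq_square field_simps)
    then have "sqrt (1 - (y / 2 - 1)\<^sup>2) = sqrt (y * (4 - y)) / 2" by (simp only: real_sqrt_divide) simp
    then have \<beta>: "1 / 2 * \<beta> (y / 2 - 1) = 2 * (sqrt (y * (4 - y)) / (2 * pi))" by (simp add: \<beta>_def)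
    have e: "ennreal (1 / 2 * \<beta> (y / 2 - 1)) = 2 * ennreal (sqrt (y * (4 - y)) / (2 * pi))"
      unfolding \<beta> by (subst ennreal_mult') simp_all
    show "ennreal (1 / 2 * \<beta> (y / 2 - 1)) * indicator {0..<1} (1 * (y / 2 - 1)) * f y +
      ennreal (1 / 2 * \<beta> (y / 2 - 1)) * indicator {0..<1} ((- 1) * (y / 2 - 1)) * f y =
      2 * (ennreal (semicircle_density y) * f y)"
      using \<open>y \<noteq> 2\<close> unfolding e
      by (auto simp: semicircle_density_def mult.assoc split: split_indicator)
  qed
  also have "\<dots> = 2 * (\<integral>\<^sup>+y. ennreal (semicircle_density y) * f y \<partial>lborel)"
    by (rule nn_integral_cmult) measurable
  finally show ?thesis
    by (simp only: ennreal_mult_cancel_left) auto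
qed

lemma nn_integral_semicircle_density: "(\<integral>\<^sup>+y. ennreal (semicircle_density y) \<partial>lborel) = 1"
  using semicircle_law[of "\<lambda>_. 1"] by (simp add: sphere.emeasure_space_1[simplified])

definition densH :: "real \<Rightarrow> ennreal" where
  "densH e = (\<integral>\<^sup>+y. ennreal (semicircle_density (e - y)) * ennreal (semicircle_density y) \<partial>lborel)"

lemma measurable_densH [measurable]: "densH \<in> borel_measurable borel"
  unfolding densH_def[abs_def] by measurable

lemma semicircle_density_le_1: "semicircle_density y \<le> 1"
proof (cases "0 < y \<and> y < 4")
  case True
  have "y * (4 - y) \<le> 2\<^sup>2"
    using zero_le_power2[of "y - 2"] by (simp add: power2_eq_square algebra_simps)
  then have "sqrt (y * (4 - y)) \<le> 2" by (rule real_le_lsqrt[rotated -1]) auto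
  then have "sqrt (y * (4 - y)) \<le> 2 * pi" using pi_ge_two by linarith
  then show ?thesis using True by (simp add: semicircle_density_def divide_le_eq)
qed (auto simp: semicircle_density_def)

lemma densH_le_1: "densH e \<le> 1"
proof -
  have "densH e \<le> (\<integral>\<^sup>+y. ennreal (semicircle_density y) \<partial>lborel)"
    unfolding densH_def
  proof (rule nn_integral_mono)
    fix y
    have "ennreal (semicircle_density (e - y)) * ennreal (semicircle_density y) \<le> 1 * ennreal (semicircle_density y)"
      by (intro mult_right_mono) (simp_all add: ennreal_le_1 semicircle_density_le_1)
    then show "ennreal (semicircle_density (e - y)) * ennreal (semicircle_density y) \<le> ennreal (semicircle_density y)"
      by simp
  qed
  then show ?thesis by (simp add: nn_integral_semicircle_density)
qed

text \<open>Finiteness lets \<open>enn2real\<close> turn this into a real-valued density without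
  loss.\<close>

lemma densH_finite: "densH e < \<infinity>"
  using order.strict_trans1[OF densH_le_1 ennreal_one_less_top] by simp

lemma trace_law_H:
  assumes [measurable]: "f \<in> borel_measurable borel"
  shows "(\<integral>\<^sup>+u. \<integral>\<^sup>+p. f (2 * Re (u $ 0) + 2 * Re (p $ 0) + 4) \<partial>(sphere_measure :: (complex^2) measure)
      \<partial>(sphere_measure :: (complex^2) measure)) = (\<integral>\<^sup>+e. densH e * f e \<partial>lborel)"
proof -
  let ?k = "\<lambda>y. ennreal (semicircle_density y)"
  have "(\<integral>\<^sup>+u. \<integral>\<^sup>+p. f (2 * Re (u $ 0) + 2 * Re (p $ 0) + 4) \<partial>(sphere_measure :: (complex^2) measure)
      \<partial>(sphere_measure :: (complex^2) measure)) =
    (\<integral>\<^sup>+u. \<integral>\<^sup>+p. f ((2 + 2 * Re (u $ 0)) + (2 + 2 * Re (p $ 0))) \<partial>(sphere_measure :: (complex^2) measure)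
      \<partial>(sphere_measure :: (complex^2) measure))"
    by (simp add: algebra_simps)
  also have "\<dots> = (\<integral>\<^sup>+u. \<integral>\<^sup>+y. ?k y * f ((2 + 2 * Re (u $ 0)) + y) \<partial>lborel \<partial>(sphere_measure :: (complex^2) measure))"
    by (intro nn_integral_cong semicircle_law[of "\<lambda>y. f (_ + y)"]) measurable
  also have "\<dots> = (\<integral>\<^sup>+x. ?k x * (\<integral>\<^sup>+y. ?k y * f (x + y) \<partial>lborel) \<partial>lborel)"
    by (rule semicircle_law) measurable
  also have "\<dots> = (\<integral>\<^sup>+x. \<integral>\<^sup>+y. ?k x * (?k y * f (x + y)) \<partial>lborel \<partial>lborel)"
    by (simp add: nn_integral_cmult)
  also have "\<dots> = (\<integral>\<^sup>+y. \<integral>\<^sup>+x. ?k x * (?k y * f (x + y)) \<partial>lborel \<partial>lborel)"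
    by (rule lborel_pair.Fubini'[symmetric]) measurable
  also have "\<dots> = (\<integral>\<^sup>+y. \<integral>\<^sup>+e. ?k (e - y) * (?k y * f e) \<partial>lborel \<partial>lborel)"
  proof (rule nn_integral_cong)
    fix y
    show "(\<integral>\<^sup>+x. ?k x * (?k y * f (x + y)) \<partial>lborel) = (\<integral>\<^sup>+e. ?k (e - y) * (?k y * f e) \<partial>lborel)"
      by (subst nn_integral_real_affine[where c = 1 and t = "- y"]) auto
  qed
  also have "\<dots> = (\<integral>\<^sup>+e. \<integral>\<^sup>+y. ?k (e - y) * (?k y * f e) \<partial>lborel \<partial>lborel)"
    by (rule lborel_pair.Fubini'[symmetric]) measurable
  also have "\<dots> = (\<integral>\<^sup>+e. densH e * f e \<partial>lborel)"
    unfolding densH_def by (subst nn_integral_multc[symmetric]) (auto simp: mult.assoc)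
  finally show ?thesis .
qed

text \<open>
  The weight is \<open>12 * t ^ 3 * (1 - t\<^sup>2)\<close>, the density of \<open>norm (fst4 x)\<close> on the unit sphere, times
  the Jacobian \<open>1 / t\<close> of scaling the trace by \<open>t\<close>.
\<close>
definition densG :: "real \<Rightarrow> ennreal" where
  "densG e = (\<integral>\<^sup>+t. ennreal (12 * t^2 * (1 - t\<^sup>2)) * indicator {0<..<1} t * densH (4 + (e - 4) / t) \<partial>lborel)"

lemma measurable_densG [measurable]: "densG \<in> borel_measurable borel"
  unfolding densG_def[abs_def] by measurable

lemma mu_eps_H4: "mu_eps H4 = density lborel densH"
proof (rule measure_eqI)
  fix A assume "A \<in> sets (mu_eps H4)"
  then have [measurable]: "A \<in> sets borel" by (simp add: mu_eps_def)
  have tr: "Re (trace (blockdiag (su2_mat u) (su2_mat p))) + 4 = 2 * Re (u $ 0) + 2 * Re (p $ 0) + 4" for u p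
    by (simp add: trace_UNIV_4 blockdiag_def blk1_def idx2_def)
  show "emeasure (mu_eps H4) A = emeasure (density lborel densH) A"
    using trace_law_H[of "indicator A"]
    by (subst emeasure_mu_eps[OF haar_eqI[OF H4_cadj is_haar_H4]]) (auto simp: tr emeasure_density)
qed (simp add: mu_eps_def)

lemma mu_eps_USp4: "mu_eps USp4 = density lborel densG"
proof (rule measure_eqI)
  fix A assume "A \<in> sets (mu_eps USp4)"
  then have [measurable]: "A \<in> sets borel" by (simp add: mu_eps_def)
  define \<psi> :: "(complex^2) \<times> (complex^2) \<Rightarrow> complex^4" where "\<psi> z = join4 (fst z) (snd z)" for z
  have lin: "linear \<psi>"
    by (rule linearI) (simp_all add: vec_eq_iff all_4 \<psi>_def)
  have iso: "distr sphere_measure borel \<psi> = sphere_measure"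
  proof (rule distr_sphere_measure_isometry[OF lin])
    show "norm (\<psi> z) = norm z" for z
    proof (rule power2_eq_imp_eq)
      show "(norm (\<psi> z))\<^sup>2 = (norm z)\<^sup>2"
        by (cases z) (simp add: \<psi>_def norm_join4 norm_Pair)
    qed simp_all
    show "surj \<psi>"
      by (rule surjI[where f = "\<lambda>x. (fst4 x, snd4 x)"]) (simp add: \<psi>_def)
  qed
  have [measurable]: "\<psi> \<in> borel_measurable borel"
    using lin linear_continuous_on linear_conv_bounded_linear borel_measurable_continuous_onI by blast
  let ?I = "\<lambda>e. indicator A e :: ennreal"
  let ?s = "sphere_measure :: (complex^2) measure"
  have [measurable]: "fst4 \<in> borel_measurable borel"
  proof (rule borel_measurable_continuous_onI)
    show "continuous_on UNIV fst4"
      unfolding fst4_def by (intro continuous_on_vec_lambda; rename_tac i; case_tac "i = 0"; simp add: continuous_intros)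
  qed
  define C where "C = real DIM(complex^2) * unit_ball_vol DIM(complex^2) * (real DIM(complex^2) * unit_ball_vol DIM(complex^2)) /
      (real (DIM(complex^2) + DIM(complex^2)) * unit_ball_vol (DIM(complex^2) + DIM(complex^2)))"
  \<comment> \<open>S^3 has area \<open>2 * pi\<^sup>2\<close> and S^7 has area
    \<open>pi ^ 4 / 3\<close>.\<close>
  have C: "C = 12"
    unfolding C_def by (simp add: eval_unit_ball_vol field_simps)
  have "emeasure (mu_eps USp4) A = (\<integral>\<^sup>+x. \<integral>\<^sup>+p. ?I (2 * Re (x$0) + 2 * norm (fst4 x) *
      Re ((su2_mat (unit_dir (snd4 x)) *v p) $ 0) + 4) \<partial>?s \<partial>sphere_measure)"
    by (subst emeasure_mu_eps[OF haar_eqI[OF USp4_cadj is_haar_USp4]]) (auto simp: Re_trace_frame4)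
  \<comment> \<open>For fixed \<open>x\<close>, left multiplication by the unit quaternion
    \<open>unit_dir (snd4 x)\<close> preserves the law of \<open>p\<close>; this removes the
    dependence on \<open>snd4 x\<close>.\<close>
  also have "\<dots> = (\<integral>\<^sup>+x. \<integral>\<^sup>+p. ?I (2 * Re (x$0) + 2 * norm (fst4 x) * Re (p $ 0) + 4) \<partial>?s \<partial>sphere_measure)"
    by (intro nn_integral_cong nn_integral_sphere_su2_mult[of _ "\<lambda>p. ?I (_ + _ * Re (p $ 0) + _)"]) auto
  also have "\<dots> = (\<integral>\<^sup>+x. \<integral>\<^sup>+p. ?I (2 * Re (x$0) + 2 * norm (fst4 x) * Re (p $ 0) + 4) \<partial>?s
      \<partial>distr sphere_measure borel \<psi>)"
    by (simp add: iso)
  also have "\<dots> = (\<integral>\<^sup>+z. \<integral>\<^sup>+p. ?I (2 * Re (\<psi> z$0) + 2 * norm (fst4 (\<psi> z)) * Re (p $ 0) + 4) \<partial>?s \<partial>sphere_measure)"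
    by (rule nn_integral_distr) measurable
  \<comment> \<open>Splitting \<open>fst z\<close> into length and direction makes the length a
    common factor of both terms of the trace.\<close>
  also have "\<dots> = (\<integral>\<^sup>+z. \<integral>\<^sup>+p. ?I (norm (fst z) * (2 * Re (sgn (fst z) $ 0) + 2 * Re (p $ 0)) + 4) \<partial>?s
     \<partial>(sphere_measure :: ((complex^2) \<times> (complex^2)) measure))"
  proof (intro nn_integral_cong arg_cong[where f = "indicator A"])
    fix z :: "(complex^2) \<times> (complex^2)" and p :: "complex^2"
    have "fst z = norm (fst z) *\<^sub>R sgn (fst z)" by (cases "fst z = 0") (simp_all add: sgn_div_norm)
    then have "fst z $ 0 = norm (fst z) *\<^sub>R (sgn (fst z) $ 0)" by (metis vector_scaleR_component)
    then have "Re (fst z $ 0) = norm (fst z) * Re (sgn (fst z) $ 0)" by simp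
    then show "2 * Re (\<psi> z$0) + 2 * norm (fst4 (\<psi> z)) * Re (p $ 0) + 4 =
       norm (fst z) * (2 * Re (sgn (fst z) $ 0) + 2 * Re (p $ 0)) + 4"
      by (simp add: \<psi>_def algebra_simps)
  qed
  also have "\<dots> = (\<integral>\<^sup>+u. \<integral>\<^sup>+t. ennreal (12 * t ^ 3 * sqrt (1 - t\<^sup>2) ^ 2) * indicator {0..<1} t *
     (\<integral>\<^sup>+p. ?I (t * (2 * Re (u $ 0) + 2 * Re (p $ 0)) + 4) \<partial>?s) \<partial>lborel \<partial>?s)"
    using nn_integral_sphere_measure_fst[where 'a = "complex^2" and 'b = "complex^2" and
      F = "\<lambda>u t. \<integral>\<^sup>+p. ?I (t * (2 * Re (u $ 0) + 2 * Re (p $ 0)) + 4) \<partial>?s"]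
    unfolding C_def[symmetric] C by simp
  also have "\<dots> = (\<integral>\<^sup>+t. \<integral>\<^sup>+u. ennreal (12 * t ^ 3 * sqrt (1 - t\<^sup>2) ^ 2) * indicator {0..<1} t *
     (\<integral>\<^sup>+p. ?I (t * (2 * Re (u $ 0) + 2 * Re (p $ 0)) + 4) \<partial>?s) \<partial>?s \<partial>lborel)"
  proof -
    interpret P: pair_sigma_finite ?s "lborel :: real measure" ..
    show ?thesis by (rule P.Fubini'[symmetric]) measurable
  qed
  also have "\<dots> = (\<integral>\<^sup>+t. \<integral>\<^sup>+e. ennreal (12 * t^2 * (1 - t\<^sup>2)) * indicator {0<..<1} t * densH (4 + (e - 4) / t) * ?I e \<partial>lborel \<partial>lborel)"
  proof (rule nn_integral_cong_AE, use AE_lborel_singleton[of 0] in eventually_elim)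
    fix t :: real assume "t \<noteq> 0"
    show "(\<integral>\<^sup>+u. ennreal (12 * t ^ 3 * sqrt (1 - t\<^sup>2) ^ 2) * indicator {0..<1} t *
         (\<integral>\<^sup>+p. ?I (t * (2 * Re (u $ 0) + 2 * Re (p $ 0)) + 4) \<partial>?s) \<partial>?s) =
       (\<integral>\<^sup>+e. ennreal (12 * t^2 * (1 - t\<^sup>2)) * indicator {0<..<1} t * densH (4 + (e - 4) / t) * ?I e \<partial>lborel)"
    proof (cases "0 < t \<and> t < 1")
      case False
      with \<open>t \<noteq> 0\<close> show ?thesis by (auto simp: indicator_def)
    next
      case True
      have t2: "t\<^sup>2 \<le> 1" using True by (simp add: power_le_one)
      let ?c = "ennreal (12 * t ^ 3 * (1 - t\<^sup>2))"
      have "(\<integral>\<^sup>+u. ennreal (12 * t ^ 3 * sqrt (1 - t\<^sup>2) ^ 2) * indicator {0..<1} t *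
           (\<integral>\<^sup>+p. ?I (t * (2 * Re (u $ 0) + 2 * Re (p $ 0)) + 4) \<partial>?s) \<partial>?s) =
         ?c * (\<integral>\<^sup>+u. \<integral>\<^sup>+p. ?I (t * ((2 * Re (u $ 0) + 2 * Re (p $ 0) + 4) - 4) + 4) \<partial>?s \<partial>?s)"
        using True t2 by (simp add: nn_integral_cmult)
      also have "\<dots> = ?c * (\<integral>\<^sup>+y. densH y * ?I (t * (y - 4) + 4) \<partial>lborel)"
        by (subst trace_law_H[of "\<lambda>y. ?I (t * (y - 4) + 4)"]) auto
      \<comment> \<open>The rescaling \<open>y = 4 + (e - 4) / t\<close> is centred at 4, the point
        where the unshifted trace vanishes.\<close>
      also have "(\<integral>\<^sup>+y. densH y * ?I (t * (y - 4) + 4) \<partial>lborel) = ennreal \<bar>1 / t\<bar> *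
          (\<integral>\<^sup>+e. densH ((4 - 4 / t) + (1 / t) * e) * ?I (t * (((4 - 4 / t) + (1 / t) * e) - 4) + 4) \<partial>lborel)"
        using True by (intro nn_integral_real_affine) auto
      also have "\<dots> = ennreal (1 / t) * (\<integral>\<^sup>+e. densH (4 + (e - 4) / t) * ?I e \<partial>lborel)"
        using True by (simp add: field_simps)
      also have "?c * \<dots> = ennreal (12 * t^2 * (1 - t\<^sup>2)) * (\<integral>\<^sup>+e. densH (4 + (e - 4) / t) * ?I e \<partial>lborel)"
      proof -
        have "?c * ennreal (1 / t) = ennreal (12 * t^2 * (1 - t\<^sup>2))"
          using True t2 by (simp add: ennreal_mult[symmetric] power2_eq_square power3_eq_cube)
        then show ?thesis by (simp only: mult.assoc[symmetric])
      qed
      also have "\<dots> = (\<integral>\<^sup>+e. ennreal (12 * t^2 * (1 - t\<^sup>2)) * indicator {0<..<1} t * densH (4 + (e - 4) / t) * ?I e \<partial>lborel)"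
        using True by (simp add: nn_integral_cmult mult.assoc)
      finally show ?thesis .
    qed
  qed
  also have "\<dots> = (\<integral>\<^sup>+e. \<integral>\<^sup>+t. ennreal (12 * t^2 * (1 - t\<^sup>2)) * indicator {0<..<1} t * densH (4 + (e - 4) / t) * ?I e \<partial>lborel \<partial>lborel)"
    by (rule lborel_pair.Fubini'[symmetric]) measurable
  also have "\<dots> = (\<integral>\<^sup>+e. densG e * ?I e \<partial>lborel)"
    unfolding densG_def by (subst nn_integral_multc[symmetric]) auto
  finally show "emeasure (mu_eps USp4) A = emeasure (density lborel densG) A"
    by (simp add: emeasure_density)
qed (simp add: mu_eps_def)

lemma densG_finite: "densG e < \<infinity>"
proof -
  have "densG e \<le> (\<integral>\<^sup>+t. 12 * indicator {0..1::real} t \<partial>lborel)"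
    unfolding densG_def
  proof (rule nn_integral_mono)
    fix t :: real
    show "ennreal (12 * t^2 * (1 - t\<^sup>2)) * indicator {0<..<1} t * densH (4 + (e - 4) / t) \<le> 12 * indicator {0..1} t"
    proof (cases "0 < t \<and> t < 1")
      case True
      then have "t\<^sup>2 \<le> 1" by (simp add: power_le_one)
      then have "12 * t^2 * (1 - t\<^sup>2) \<le> 12" using mult_mono[of "t\<^sup>2" 1 "1 - t\<^sup>2" 1] by simp
      then have "ennreal (12 * t^2 * (1 - t\<^sup>2)) * densH (4 + (e - 4) / t) \<le> ennreal 12 * 1"
        by (intro mult_mono ennreal_leI densH_le_1) auto
      then show ?thesis using True by simp
    qed (auto simp: indicator_def)
  qed
  also have "\<dots> < \<infinity>" by (subst nn_integral_cmult) (auto simp: ennreal_mult_less_top)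
  finally show ?thesis .
qed

subsection \<open>Behaviour of the densities at the edge\<close>

text \<open>The graph of the integrand is a semicircle of diameter \<open>e\<close>. Its area comes
  from rescaling the total mass 1 of \<open>semicircle_density\<close>, so no trigonometric
  antiderivative is needed.\<close>

lemma nn_integral_half_disc:
  assumes e: "0 < e"
  shows "(\<integral>\<^sup>+y. ennreal (sqrt (y * (e - y))) * indicator {0<..<e} y \<partial>lborel) = ennreal (pi * e\<^sup>2 / 8)"
proof -
  let ?I = "\<integral>\<^sup>+y. ennreal (sqrt (y * (e - y))) * indicator {0<..<e} y \<partial>lborel"
  have "1 = ennreal (4 / e) * (\<integral>\<^sup>+y. ennreal (semicircle_density (4 / e * y)) \<partial>lborel)"
    using nn_integral_semicircle_density e
    by (subst (asm) nn_integral_real_affine[where c = "4 / e" and t = 0]) simp_all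
  also have "(\<integral>\<^sup>+y. ennreal (semicircle_density (4 / e * y)) \<partial>lborel) =
     (\<integral>\<^sup>+y. ennreal (2 / (e * pi)) * (ennreal (sqrt (y * (e - y))) * indicator {0<..<e} y) \<partial>lborel)"
  proof (rule nn_integral_cong)
    fix y
    have "4 / e * y * (4 - 4 / e * y) = (4 / e)\<^sup>2 * (y * (e - y))"
      using e by (simp add: field_simps power2_eq_square)
    then have "sqrt (4 / e * y * (4 - 4 / e * y)) = 4 / e * sqrt (y * (e - y))"
      using e by (simp only: real_sqrt_mult) simp
    moreover have "0 < 4 / e * y \<and> 4 / e * y < 4 \<longleftrightarrow> 0 < y \<and> y < e"
      using e by (auto simp: field_simps zero_less_mult_iff zero_less_divide_iff)
    ultimately show "ennreal (semicircle_density (4 / e * y)) =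
       ennreal (2 / (e * pi)) * (ennreal (sqrt (y * (e - y))) * indicator {0<..<e} y)"
      using e unfolding semicircle_density_def by (simp add: ennreal_mult[symmetric] split: split_indicator)
  qed
  also have "\<dots> = ennreal (2 / (e * pi)) * ?I" by (rule nn_integral_cmult) measurable
  finally have "1 = ennreal (4 / e) * (ennreal (2 / (e * pi)) * ?I)" .
  then have "ennreal (pi * e\<^sup>2 / 8) = ennreal (pi * e\<^sup>2 / 8) * (ennreal (4 / e) * (ennreal (2 / (e * pi)) * ?I))"
    by simp
  also have "\<dots> = ennreal (pi * e\<^sup>2 / 8 * (4 / e) * (2 / (e * pi))) * ?I"
  proof -
    have "ennreal (pi * e\<^sup>2 / 8 * (4 / e) * (2 / (e * pi))) = ennreal (pi * e\<^sup>2 / 8) * ennreal (4 / e) * ennreal (2 / (e * pi))"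
      using e by (subst ennreal_mult, simp, simp, subst ennreal_mult, simp, simp) (rule refl)
    then show ?thesis by (simp only: mult.assoc)
  qed
  also have "pi * e\<^sup>2 / 8 * (4 / e) * (2 / (e * pi)) = 1"
    using e by (simp add: field_simps power2_eq_square)
  finally show ?thesis by simp
qed

definition polyH :: "real \<Rightarrow> real" where
  "polyH e = e\<^sup>2 / (8 * pi) - e ^ 3 / (64 * pi)"

lemma densH_nonpos: "e \<le> 0 \<Longrightarrow> densH e = 0"
  unfolding densH_def by (auto simp: semicircle_density_def intro!: nn_integral_zero')

text \<open>The square roots vanishing at \<open>y = 0\<close> and \<open>y = e\<close> are split
  off and integrate to a half disc. The remaining weight \<open>sqrt ((4 - y) * (4 - e + y))\<close>
  lies within \<open>e\<^sup>2 / 8\<close> below \<open>4 - e / 2\<close>, and that constant alone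
  gives \<open>polyH\<close>.\<close>

lemma densH_bounds:
  assumes e: "0 < e" "e \<le> 1"
  shows "densH e \<le> ennreal (polyH e)" "ennreal (polyH e - e ^ 4 / (256 * pi)) \<le> densH e"
proof -
  let ?w = "\<lambda>y. sqrt ((4 - y) * (4 - e + y))"
  let ?g = "\<lambda>y. ennreal (sqrt (y * (e - y))) * indicator {0<..<e} y"
  have dens: "densH e = (\<integral>\<^sup>+y. ennreal (?w y / (4 * pi\<^sup>2)) * ?g y \<partial>lborel)"
    unfolding densH_def
  proof (rule nn_integral_cong)
    fix y
    show "ennreal (semicircle_density (e - y)) * ennreal (semicircle_density y) = ennreal (?w y / (4 * pi\<^sup>2)) * ?g y"
    proof (cases "0 < y \<and> y < e")
      case True
      have "sqrt ((e - y) * (4 - (e - y))) * sqrt (y * (4 - y)) = ?w y * sqrt (y * (e - y))"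
        by (simp add: real_sqrt_mult[symmetric] algebra_simps)
      then have "semicircle_density (e - y) * semicircle_density y = ?w y / (4 * pi\<^sup>2) * sqrt (y * (e - y))"
        using True e by (simp add: semicircle_density_def power2_eq_square)
      then show ?thesis using True e by (simp add: ennreal_mult[symmetric])
    qed (auto simp: semicircle_density_def)
  qed
  have const: "(\<integral>\<^sup>+y. ennreal (c / (4 * pi\<^sup>2)) * ?g y \<partial>lborel) = ennreal (c * e\<^sup>2 / (32 * pi))" if "0 \<le> c" for c
  proof -
    have "(\<integral>\<^sup>+y. ennreal (c / (4 * pi\<^sup>2)) * ?g y \<partial>lborel) = ennreal (c / (4 * pi\<^sup>2)) * ennreal (pi * e\<^sup>2 / 8)"
      by (subst nn_integral_cmult) (simp_all add: nn_integral_half_disc e)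
    also have "\<dots> = ennreal (c / (4 * pi\<^sup>2) * (pi * e\<^sup>2 / 8))"
      using that e by (subst ennreal_mult) simp_all
    also have "c / (4 * pi\<^sup>2) * (pi * e\<^sup>2 / 8) = c * e\<^sup>2 / (32 * pi)"
      by (simp add: field_simps power2_eq_square)
    finally show ?thesis .
  qed
  \<comment> \<open>The two factors under the root add up to \<open>8 - e\<close>, so this is the
    inequality of arithmetic and geometric means.\<close>
  have up: "?w y \<le> 4 - e / 2" if "0 < y" "y < e" for y
  proof (rule real_le_lsqrt)
    show "(4 - y) * (4 - e + y) \<le> (4 - e / 2)\<^sup>2"
      using zero_le_power2[of "y - e / 2"] by (simp add: power2_eq_square field_simps)
  qed (use that e in auto)
  \<comment> \<open>The product under the root is at least \<open>16 - 4 * e\<close>, whose root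
    expands as \<open>4 - e / 2 - e\<^sup>2 / 32 - ...\<close>; the coefficient 1/8 leaves room for
    the remaining terms.\<close>
  have lo: "4 - e / 2 - e\<^sup>2 / 8 \<le> ?w y" if "0 < y" "y < e" for y
  proof (rule real_le_rsqrt)
    have e2: "e\<^sup>2 \<le> 1" using e by (simp add: power_le_one)
    have "(4 - e / 2 - e\<^sup>2 / 8)\<^sup>2 = 16 - 4 * e + e\<^sup>2 * (e / 8 + e\<^sup>2 / 64 - 3 / 4)"
      by (simp add: power2_eq_square field_simps)
    also have "\<dots> \<le> 16 - 4 * e"
      using e e2 by (simp add: mult_le_0_iff)
    also have "\<dots> \<le> (4 - y) * (4 - e + y)"
      using mult_nonneg_nonneg[of y "e - y"] that by (simp add: algebra_simps)
    finally show "(4 - e / 2 - e\<^sup>2 / 8)\<^sup>2 \<le> (4 - y) * (4 - e + y)" .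
  qed
  have "densH e \<le> (\<integral>\<^sup>+y. ennreal ((4 - e / 2) / (4 * pi\<^sup>2)) * ?g y \<partial>lborel)"
    unfolding dens
    by (intro nn_integral_mono)
       (auto intro!: mult_right_mono ennreal_leI divide_right_mono up split: split_indicator)
  also have "\<dots> = ennreal ((4 - e / 2) * e\<^sup>2 / (32 * pi))" using e by (intro const) auto
  also have "(4 - e / 2) * e\<^sup>2 / (32 * pi) = polyH e"
    by (simp add: polyH_def field_simps power2_eq_square power3_eq_cube)
  finally show "densH e \<le> ennreal (polyH e)" .
  have e2: "e\<^sup>2 \<le> 1" using e by (simp add: power_le_one)
  have "polyH e - e ^ 4 / (256 * pi) = (4 - e / 2 - e\<^sup>2 / 8) * e\<^sup>2 / (32 * pi)"
    by (simp add: polyH_def field_simps power2_eq_square power3_eq_cube power4_eq_xxxx)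
  also have "ennreal \<dots> = (\<integral>\<^sup>+y. ennreal ((4 - e / 2 - e\<^sup>2 / 8) / (4 * pi\<^sup>2)) * ?g y \<partial>lborel)"
    using e e2 by (intro const[symmetric]) auto
  also have "\<dots> \<le> densH e"
    unfolding dens
    by (intro nn_integral_mono)
       (auto intro!: mult_right_mono ennreal_leI divide_right_mono lo split: split_indicator)
  finally show "ennreal (polyH e - e ^ 4 / (256 * pi)) \<le> densH e" .
qed

section \<open>The density on USp(4) near the edge\<close>

definition polyG :: "real \<Rightarrow> real" where
  "polyG e = e ^ 4 / (64 * pi) - e ^ 5 / (512 * pi)"

text \<open>With \<open>m = 4 * t - 4 + e\<close>, the argument of \<open>densH\<close> inside
  \<open>densG\<close> is \<open>m / t\<close>, and \<open>t\<^sup>2 * polyH (m / t)\<close> equals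
  \<open>m\<^sup>2 / (8 * pi) - m ^ 3 / (64 * pi * t)\<close>. Replacing the last
  \<open>1 / t\<close> by 1 gives a polynomial, at a cost of higher order.\<close>

definition integrandG :: "real \<Rightarrow> real \<Rightarrow> real" where
  "integrandG e t = 12 * (1 - t\<^sup>2) * ((4 * t - 4 + e)\<^sup>2 / (8 * pi) - (4 * t - 4 + e) ^ 3 / (64 * pi))"

lemma nn_integral_integrandG:
  assumes e: "0 < e" "e \<le> 1"
  shows "(\<integral>\<^sup>+t. ennreal (integrandG e t) * indicator {1 - e / 4..1} t \<partial>lborel) = ennreal (polyG e + e ^ 6 / (20480 * pi))"
proof -
  \<comment> \<open>These are \<open>pi\<close> times the coefficients of the bracket in
    \<open>integrandG\<close> as a polynomial in \<open>v = 1 - t\<close>, where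
    \<open>4 * t - 4 + e = e - 4 * v\<close>. Multiplying by
    \<open>1 - t\<^sup>2 = 2 * v - v\<^sup>2\<close> and integrating gives \<open>F\<close>.\<close>
  define b0 b1 b2 b3 where "b0 = e\<^sup>2 / 8 - e ^ 3 / 64" and "b1 = 12 * e\<^sup>2 / 64 - e"
    and "b2 = 2 - 48 * e / 64" and "b3 = (1 :: real)"
  define F where "F t = - 12 / pi * (b0 * (1 - t)\<^sup>2 + (2 * b1 - b0) * (1 - t) ^ 3 / 3 + (2 * b2 - b1) * (1 - t) ^ 4 / 4
     + (2 * b3 - b2) * (1 - t) ^ 5 / 5 - b3 * (1 - t) ^ 6 / 6)" for t
  have F': "(F has_real_derivative integrandG e t) (at t)" for t
  proof -
    have "(F has_real_derivative 12 / pi * (2 * b0 * (1 - t) + (2 * b1 - b0) * (1 - t)\<^sup>2 + (2 * b2 - b1) * (1 - t) ^ 3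
      + (2 * b3 - b2) * (1 - t) ^ 4 - b3 * (1 - t) ^ 5)) (at t)"
      unfolding F_def by (auto intro!: derivative_eq_intros simp: field_simps)
    also have "12 / pi * (2 * b0 * (1 - t) + (2 * b1 - b0) * (1 - t)\<^sup>2 + (2 * b2 - b1) * (1 - t) ^ 3
      + (2 * b3 - b2) * (1 - t) ^ 4 - b3 * (1 - t) ^ 5) = integrandG e t"
      by (simp add: integrandG_def b0_def b1_def b2_def b3_def field_simps) algebra
    finally show ?thesis .
  qed
  have "(\<integral>\<^sup>+t. ennreal (integrandG e t) * indicator {1 - e / 4..1} t \<partial>lborel) = ennreal (F 1 - F (1 - e / 4))"
  proof (rule nn_integral_FTC_Icc[OF _ F'])
    show "integrandG e \<in> borel_measurable borel"
      unfolding integrandG_def[abs_def] by measurable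
    fix t assume t: "t \<in> {1 - e / 4..1}"
    define m where "m = 4 * t - 4 + e"
    have m: "0 \<le> m" "m \<le> 1" using t e by (auto simp: m_def)
    have "m\<^sup>2 / (8 * pi) - m ^ 3 / (64 * pi) = m\<^sup>2 * (8 - m) / (64 * pi)"
      by (simp add: field_simps power2_eq_square power3_eq_cube)
    also have "\<dots> \<ge> 0" using m by simp
    finally have "0 \<le> m\<^sup>2 / (8 * pi) - m ^ 3 / (64 * pi)" .
    moreover have "t\<^sup>2 \<le> 1" using t e by (auto intro!: power_le_one)
    ultimately show "0 \<le> integrandG e t" unfolding integrandG_def m_def by simp
  qed (use e in auto)
  also have "F 1 - F (1 - e / 4) = polyG e + e ^ 6 / (20480 * pi)"
    by (simp add: F_def polyG_def b0_def b1_def b2_def b3_def field_simps) algebra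
  finally show ?thesis .
qed

text \<open>Only \<open>t > 1 - e / 4\<close> matters, because \<open>densH\<close> vanishes at
  nonpositive arguments. There the integrand is below \<open>integrandG\<close> by at most
  \<open>6 * e ^ 5\<close>: an error \<open>e ^ 4\<close> times the weight
  \<open>12 * (1 - t\<^sup>2)\<close>, which is at most \<open>6 * e\<close>. The interval has
  length \<open>e / 4\<close>, whence \<open>3 / 2 * e ^ 6\<close>. That error is added to
  \<open>densG\<close> because subtraction in \<open>ennreal\<close> truncates.\<close>

lemma densG_bounds:
  assumes e: "0 < e" "e \<le> 1"
  shows "densG e \<le> ennreal (polyG e + e ^ 6 / (20480 * pi))"
    "ennreal (polyG e + e ^ 6 / (20480 * pi)) \<le> densG e + ennreal (3 / 2 * e ^ 6)"
proof -
  let ?f = "\<lambda>t. ennreal (12 * t\<^sup>2 * (1 - t\<^sup>2)) * indicator {0<..<1} t * densH (4 + (e - 4) / t)"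
  let ?J = "{1 - e / 4..1}"
  let ?J' = "\<lambda>t. indicator {1 - e / 4..1} t :: ennreal"
  have key: "?f t \<le> ennreal (integrandG e t)" "ennreal (integrandG e t) \<le> ?f t + ennreal (6 * e ^ 5)"
    if t: "1 - e / 4 < t" "t < 1" for t
  proof -
    define m where "m = 4 * t - 4 + e"
    have m: "0 < m" "m \<le> e" using t e by (auto simp: m_def)
    have t34: "3 / 4 \<le> t" "0 < t" using t e by auto
    have \<delta>: "4 + (e - 4) / t = m / t" using t34 by (simp add: m_def field_simps)
    \<comment> \<open>Indeed \<open>e * t - m = (4 - e) * (1 - t)\<close>; hence
      \<open>m / t\<close> stays in the range where \<open>densH_bounds\<close> applies.\<close>
    have "m \<le> e * t"
    proof -
      have "0 \<le> (4 - e) * (1 - t)" using t e by simp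
      then show ?thesis by (simp add: m_def algebra_simps)
    qed
    then have \<delta>1: "0 < m / t" "m / t \<le> 1"
      using m t34 e by (auto simp: divide_le_eq intro: order_trans[OF _ mult_right_mono[of e 1 t, simplified]])
    have tt: "0 \<le> 1 - t\<^sup>2" "1 - t\<^sup>2 \<le> e / 2"
    proof -
      have "1 - t\<^sup>2 = (1 - t) * (1 + t)" by (simp add: power2_eq_square algebra_simps)
      moreover have "(1 - t) * (1 + t) \<le> e / 4 * 2" using t t34 by (intro mult_mono) auto
      moreover have "0 \<le> (1 - t) * (1 + t)" using t t34 by simp
      ultimately show "0 \<le> 1 - t\<^sup>2" "1 - t\<^sup>2 \<le> e / 2" by auto
    qed
    define u where "u = 1 / t"
    have u: "1 \<le> u" "u \<le> 4 / 3" "u * t = 1" using t34 t by (auto simp: u_def field_simps)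
    have m3: "m ^ 3 \<le> m ^ 3 * u" using u m by simp
    have "u - 1 = u * (1 - t)" using u by (simp add: algebra_simps)
    also have "\<dots> \<le> 4 / 3 * (e / 4)" using u t by (intro mult_mono) auto
    finally have u1: "u \<le> 1 + e / 3" by simp
    have "m ^ 3 * u \<le> m ^ 3 * (1 + e / 3)" using u1 m by (intro mult_left_mono) auto
    also have "\<dots> = m ^ 3 + m ^ 3 * e / 3" by (simp add: algebra_simps)
    also have "m ^ 3 * e \<le> e ^ 3 * e" using m e by (intro mult_right_mono power_mono) auto
    finally have m3': "m ^ 3 * u \<le> m ^ 3 + e ^ 4 / 3" by (simp add: power3_eq_cube power4_eq_xxxx mult.assoc)
    have "m ^ 4 * u\<^sup>2 \<le> e ^ 4 * (4 / 3)\<^sup>2" using m e u by (intro mult_mono power_mono) auto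
    also have "\<dots> \<le> 2 * e ^ 4" by (simp add: power2_eq_square)
    finally have m4: "m ^ 4 * u\<^sup>2 \<le> 2 * e ^ 4" .
    have mt: "m / t = m * u" by (simp add: u_def)
    have t2P: "t\<^sup>2 * polyH (m / t) = m\<^sup>2 / (8 * pi) - m ^ 3 * u / (64 * pi)"
    proof -
      have "t\<^sup>2 * polyH (m / t) = (u * t)\<^sup>2 * m\<^sup>2 / (8 * pi) - (u * t)\<^sup>2 * m ^ 3 * u / (64 * pi)"
        unfolding mt polyH_def by (simp add: power2_eq_square power3_eq_cube algebra_simps)
      then show ?thesis by (simp add: u)
    qed
    have t2E: "t\<^sup>2 * ((m / t) ^ 4 / (256 * pi)) = m ^ 4 * u\<^sup>2 / (256 * pi)"
    proof -
      have "t\<^sup>2 * ((m / t) ^ 4 / (256 * pi)) = (u * t)\<^sup>2 * (m ^ 4 * u\<^sup>2 / (256 * pi))"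
        unfolding mt by (simp add: power2_eq_square power4_eq_xxxx algebra_simps)
      then show ?thesis by (simp add: u)
    qed
    have f: "?f t = ennreal (12 * (1 - t\<^sup>2)) * (ennreal (t\<^sup>2) * densH (m / t))"
    proof -
      have "ennreal (12 * t\<^sup>2 * (1 - t\<^sup>2)) = ennreal (12 * (1 - t\<^sup>2)) * ennreal (t\<^sup>2)"
        using tt by (subst ennreal_mult[symmetric]) (simp_all add: algebra_simps)
      then show ?thesis using t t34 unfolding \<delta> by (simp only: mult.assoc) simp
    qed
    have "ennreal (t\<^sup>2) * densH (m / t) \<le> ennreal (t\<^sup>2) * ennreal (polyH (m / t))"
      by (intro mult_left_mono densH_bounds \<delta>1) auto
    also have "\<dots> = ennreal (m\<^sup>2 / (8 * pi) - m ^ 3 * u / (64 * pi))"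
      by (simp add: ennreal_mult'[symmetric] t2P)
    also have "\<dots> \<le> ennreal (m\<^sup>2 / (8 * pi) - m ^ 3 / (64 * pi))"
      using m3 by (intro ennreal_leI diff_left_mono divide_right_mono) auto
    finally have "?f t \<le> ennreal (12 * (1 - t\<^sup>2)) * ennreal (m\<^sup>2 / (8 * pi) - m ^ 3 / (64 * pi))"
      unfolding f by (intro mult_left_mono) auto
    then show "?f t \<le> ennreal (integrandG e t)"
      using tt by (simp add: integrandG_def m_def[symmetric] ennreal_mult'[symmetric])
    have "m\<^sup>2 / (8 * pi) - m ^ 3 / (64 * pi) \<le> t\<^sup>2 * (polyH (m / t) - (m / t) ^ 4 / (256 * pi)) + e ^ 4"
    proof -
      have "(m ^ 3 * u - m ^ 3) / (64 * pi) + m ^ 4 * u\<^sup>2 / (256 * pi) \<le> (e ^ 4 / 3) / (64 * pi) + (2 * e ^ 4) / (256 * pi)"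
        using m3' m4 by (intro add_mono divide_right_mono) auto
      also have "\<dots> = e ^ 4 * (5 / 384) / pi" by (simp add: field_simps)
      \<comment> \<open>Only the order in \<open>e\<close> matters, so 5/384 is generously replaced
        by \<open>pi\<close> to cancel the denominator.\<close>
      also have "\<dots> \<le> e ^ 4 * pi / pi" using e pi_ge_two by (intro divide_right_mono mult_left_mono) auto
      finally have "(m ^ 3 * u - m ^ 3) / (64 * pi) + m ^ 4 * u\<^sup>2 / (256 * pi) \<le> e ^ 4" by simp
      then show ?thesis unfolding right_diff_distrib t2P t2E by (simp add: diff_divide_distrib)
    qed
    then have "ennreal (m\<^sup>2 / (8 * pi) - m ^ 3 / (64 * pi)) \<le> ennreal (t\<^sup>2 * (polyH (m / t) - (m / t) ^ 4 / (256 * pi)) + e ^ 4)"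
      by (rule ennreal_leI)
    \<comment> \<open>The first summand may be negative; \<open>ennreal\<close> then truncates it to
      0, which only enlarges the right-hand side.\<close>
    also have "\<dots> \<le> ennreal (t\<^sup>2 * (polyH (m / t) - (m / t) ^ 4 / (256 * pi))) + ennreal (e ^ 4)"
      using e by (cases "0 \<le> t\<^sup>2 * (polyH (m / t) - (m / t) ^ 4 / (256 * pi))") (simp_all add: ennreal_neg ennreal_leI)
    also have "ennreal (t\<^sup>2 * (polyH (m / t) - (m / t) ^ 4 / (256 * pi))) = ennreal (t\<^sup>2) * ennreal (polyH (m / t) - (m / t) ^ 4 / (256 * pi))"
      by (simp add: ennreal_mult')
    also have "\<dots> \<le> ennreal (t\<^sup>2) * densH (m / t)"
      by (intro mult_left_mono densH_bounds \<delta>1) auto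
    finally have lower: "ennreal (m\<^sup>2 / (8 * pi) - m ^ 3 / (64 * pi)) \<le> ennreal (t\<^sup>2) * densH (m / t) + ennreal (e ^ 4)"
      by (simp add: add_right_mono)
    have "ennreal (integrandG e t) = ennreal (12 * (1 - t\<^sup>2)) * ennreal (m\<^sup>2 / (8 * pi) - m ^ 3 / (64 * pi))"
      using tt by (simp add: integrandG_def m_def[symmetric] ennreal_mult'[symmetric])
    also have "\<dots> \<le> ennreal (12 * (1 - t\<^sup>2)) * (ennreal (t\<^sup>2) * densH (m / t) + ennreal (e ^ 4))"
      using lower by (intro mult_left_mono) auto
    also have "\<dots> = ?f t + ennreal (12 * (1 - t\<^sup>2) * e ^ 4)"
      unfolding f using tt by (simp add: distrib_left ennreal_mult')
    also have "12 * (1 - t\<^sup>2) * e ^ 4 \<le> 12 * (e / 2) * e ^ 4"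
      using tt by (intro mult_right_mono mult_left_mono) auto
    also have "12 * (e / 2) * e ^ 4 = 6 * e ^ 5" by (simp add: eval_nat_numeral)
    finally show "ennreal (integrandG e t) \<le> ?f t + ennreal (6 * e ^ 5)"
      by (simp add: ennreal_leI add_left_mono)
  qed
  have outside: "?f t = 0" if "t \<notin> ?J" "t \<noteq> 0" for t
  proof (cases "0 < t \<and> t < 1")
    case True
    with that have "4 * t - 4 + e \<le> 0" by auto
    then have "4 + (e - 4) / t \<le> 0" using True by (simp add: field_simps)
    then show ?thesis by (simp add: densH_nonpos)
  qed auto
  have AE: "AE t in lborel. t \<noteq> 0 \<and> t \<noteq> 1 \<and> t \<noteq> 1 - e / 4"
    using AE_lborel_singleton[of 0] AE_lborel_singleton[of 1] AE_lborel_singleton[of "1 - e / 4"]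
    by eventually_elim auto
  have int: "(\<integral>\<^sup>+t. ennreal (integrandG e t) * ?J' t \<partial>lborel) = ennreal (polyG e + e ^ 6 / (20480 * pi))"
    by (rule nn_integral_integrandG[OF e])
  have "densG e \<le> (\<integral>\<^sup>+t. ennreal (integrandG e t) * ?J' t \<partial>lborel)"
    unfolding densG_def
  proof (rule nn_integral_mono_AE, use AE in eventually_elim)
    fix t assume t: "t \<noteq> 0 \<and> t \<noteq> 1 \<and> t \<noteq> 1 - e / 4"
    show "?f t \<le> ennreal (integrandG e t) * ?J' t"
      using t key(1)[of t] outside[of t] by (cases "t \<in> ?J") auto
  qed
  then show "densG e \<le> ennreal (polyG e + e ^ 6 / (20480 * pi))" unfolding int .
  have "(\<integral>\<^sup>+t. ennreal (integrandG e t) * ?J' t \<partial>lborel) \<le> (\<integral>\<^sup>+t. ?f t + ennreal (6 * e ^ 5) * ?J' t \<partial>lborel)"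
  proof (rule nn_integral_mono_AE, use AE in eventually_elim)
    fix t assume t: "t \<noteq> 0 \<and> t \<noteq> 1 \<and> t \<noteq> 1 - e / 4"
    show "ennreal (integrandG e t) * ?J' t \<le> ?f t + ennreal (6 * e ^ 5) * ?J' t"
      using t key(2)[of t] by (cases "t \<in> ?J") auto
  qed
  also have "\<dots> = densG e + (\<integral>\<^sup>+t. ennreal (6 * e ^ 5) * ?J' t \<partial>lborel)"
    unfolding densG_def by (rule nn_integral_add) measurable
  also have "(\<integral>\<^sup>+t. ennreal (6 * e ^ 5) * ?J' t \<partial>lborel) = ennreal (3 / 2 * e ^ 6)"
    using e by (subst nn_integral_cmult) (auto simp: ennreal_mult[symmetric] eval_nat_numeral)
  finally show "ennreal (polyG e + e ^ 6 / (20480 * pi)) \<le> densG e + ennreal (3 / 2 * e ^ 6)" unfolding int .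
qed

section \<open>Asymptotic expansions and conclusion\<close>

lemma densH_asymp:
  "(\<lambda>e. enn2real (densH e) - polyH e) \<in> O[at_right 0](\<lambda>e. e ^ 4)"
proof (rule bigoI[where c = 1])
  have "eventually (\<lambda>e::real. e \<in> {0<..<1}) (at_right 0)"
    by (rule eventually_at_right_real) simp
  then show "eventually (\<lambda>e. norm (enn2real (densH e) - polyH e) \<le> 1 * norm (e ^ 4)) (at_right 0)"
  proof eventually_elim
    fix e :: real assume "e \<in> {0<..<1}"
    then have e: "0 < e" "e \<le> 1" by auto
    have fin: "densH e = ennreal (enn2real (densH e))"
      using densH_finite[of e] by (simp add: ennreal_enn2real)
    have P: "0 \<le> polyH e"
    proof -
      have "polyH e = e\<^sup>2 * (8 - e) / (64 * pi)"
        by (simp add: polyH_def field_simps power2_eq_square power3_eq_cube)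
      then show ?thesis using e by simp
    qed
    have "enn2real (densH e) \<le> polyH e"
      using densH_bounds(1)[OF e] P by (subst (asm) fin) simp
    moreover have "polyH e - e ^ 4 / (256 * pi) \<le> enn2real (densH e)"
      using densH_bounds(2)[OF e] by (subst (asm) fin) (simp add: ennreal_le_iff[OF enn2real_nonneg])
    moreover have "e ^ 4 / (256 * pi) \<le> e ^ 4 / 1"
      using pi_ge_two e by (intro divide_left_mono) auto
    ultimately show "norm (enn2real (densH e) - polyH e) \<le> 1 * norm (e ^ 4)"
      by simp
  qed
qed

lemma densG_asymp:
  "(\<lambda>e. enn2real (densG e) - polyG e) \<in> O[at_right 0](\<lambda>e. e ^ 6)"
proof (rule bigoI[where c = 2])
  have "eventually (\<lambda>e::real. e \<in> {0<..<1}) (at_right 0)"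
    by (rule eventually_at_right_real) simp
  then show "eventually (\<lambda>e. norm (enn2real (densG e) - polyG e) \<le> 2 * norm (e ^ 6)) (at_right 0)"
  proof eventually_elim
    fix e :: real assume "e \<in> {0<..<1}"
    then have e: "0 < e" "e \<le> 1" by auto
    have fin: "densG e = ennreal (enn2real (densG e))"
      using densG_finite[of e] by (simp add: ennreal_enn2real)
    have P: "0 \<le> polyG e"
    proof -
      have "polyG e = e ^ 4 * (8 - e) / (512 * pi)"
        by (simp add: polyG_def field_simps eval_nat_numeral)
      then show ?thesis using e by simp
    qed
    have e6: "0 \<le> e ^ 6" using e by simp
    have "enn2real (densG e) \<le> polyG e + e ^ 6 / (20480 * pi)"
      using densG_bounds(1)[OF e] P e6 by (subst (asm) fin) (simp del: ennreal_plus)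
    moreover have "polyG e + e ^ 6 / (20480 * pi) \<le> enn2real (densG e) + 3 / 2 * e ^ 6"
      using densG_bounds(2)[OF e] P e6
      by (subst (asm) fin) (simp add: ennreal_plus[symmetric] del: ennreal_plus)
    moreover have "e ^ 6 / (20480 * pi) \<le> e ^ 6 / 1"
      using pi_ge_two e by (intro divide_left_mono) auto
    moreover have "0 \<le> e ^ 6 / (20480 * pi)" using e6 by simp
    moreover have "norm (e ^ 6) = e ^ 6" using e6 by simp
    ultimately show "norm (enn2real (densG e) - polyG e) \<le> 2 * norm (e ^ 6)"
      unfolding real_norm_def abs_le_iff using e6 by linarith
  qed
qed

theorem theorem6:
  shows "(\<exists>d::real \<Rightarrow> real. (\<forall>x. 0 \<le> d x) \<and> d \<in> borel_measurable borel \<and>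
            mu_eps USp4 = density lborel (\<lambda>x. ennreal (d x)) \<and>
            (\<lambda>e. d e - e^4 * (8 - e) / (512 * pi)) \<in> O[at_right 0](\<lambda>e. e^6) \<and>
            (\<lambda>e. d e - (e^4 / (64 * pi) - e^5 / (512 * pi))) \<in> O[at_right 0](\<lambda>e. e^6))
       \<and> (\<exists>d::real \<Rightarrow> real. (\<forall>x. 0 \<le> d x) \<and> d \<in> borel_measurable borel \<and>
            mu_eps H4 = density lborel (\<lambda>x. ennreal (d x)) \<and>
            (\<lambda>e. d e - e^2 * (8 - e) / (64 * pi)) \<in> O[at_right 0](\<lambda>e. e^4) \<and>
            (\<lambda>e. d e - (e^2 / (8 * pi) - e^3 / (64 * pi))) \<in> O[at_right 0](\<lambda>e. e^4))"
proof (rule conjI[OF exI[of _ "\<lambda>e. enn2real (densG e)"] exI[of _ "\<lambda>e. enn2real (densH e)"]]; intro conjI allI)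
  have G: "ennreal (enn2real (densG e)) = densG e" for e
    using densG_finite[of e] by (simp add: ennreal_enn2real)
  have H: "ennreal (enn2real (densH e)) = densH e" for e
    using densH_finite[of e] by (simp add: ennreal_enn2real)
  show "mu_eps USp4 = density lborel (\<lambda>x. ennreal (enn2real (densG x)))"
    by (simp add: G mu_eps_USp4)
  show "mu_eps H4 = density lborel (\<lambda>x. ennreal (enn2real (densH x)))"
    by (simp add: H mu_eps_H4)
  have "polyG e = e ^ 4 * (8 - e) / (512 * pi)" for e
    by (simp add: polyG_def field_simps eval_nat_numeral)
  with densG_asymp show "(\<lambda>e. enn2real (densG e) - e^4 * (8 - e) / (512 * pi)) \<in> O[at_right 0](\<lambda>e. e^6)"
    by simp
  show "(\<lambda>e. enn2real (densG e) - (e^4 / (64 * pi) - e^5 / (512 * pi))) \<in> O[at_right 0](\<lambda>e. e^6)"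
    using densG_asymp by (simp add: polyG_def)
  have "polyH e = e\<^sup>2 * (8 - e) / (64 * pi)" for e
    by (simp add: polyH_def field_simps eval_nat_numeral)
  with densH_asymp show "(\<lambda>e. enn2real (densH e) - e^2 * (8 - e) / (64 * pi)) \<in> O[at_right 0](\<lambda>e. e^4)"
    by simp
  show "(\<lambda>e. enn2real (densH e) - (e^2 / (8 * pi) - e^3 / (64 * pi))) \<in> O[at_right 0](\<lambda>e. e^4)"
    using densH_asymp by (simp add: polyH_def)
qed auto

end
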